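(* Fix a constant $\alpha\in(0,1)$. Then there are constants $c_1=c_1(\alpha)>0$, $c_2=c_2(c_1,\alpha)>0$ and $c_3=c_3(\alpha)>0$ such that, for all sufficiently large integers $n,d$ with $d\le \alpha n$, every $\left(n,\left(1\pm c_3(\lambda/d)^{1/3}\right)d,\lambda\right)$-graph $G$ with $\lambda\le c_1 d$ contains an induced cycle of length at least $c_2\, n\log(d/\lambda)/d$.
   Context: For $\gamma\ge 0$ (possibly depending on $n,d,\lambda$), a graph $G$ is an $(n,(1\pm\gamma)d,\lambda)$-graph if $G$ has $n$ vertices, every vertex has degree in $[(1-\gamma)d,(1+\gamma)d]$, and all eigenvalues of the adjacency matrix of $G$ except the largest one have absolute value at most $\lambda$. Graphs are finite and simple; $\log$ is the natural logarithm. *)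

theory Defs
  imports "Jordan_Normal_Form.Char_Poly"
begin

text \<open>
  A graph on \<open>n\<close> vertices has vertex set \<open>{..<n}\<close> and is given by its set of edges, each edge being
  a two-element set of vertices.
\<close>

definition simple_graph :: "nat \<Rightarrow> nat set set \<Rightarrow> bool" where
  "simple_graph n E \<longleftrightarrow> E \<subseteq> {e. e \<subseteq> {..<n} \<and> card e = 2}"

definition degree_in :: "nat set set \<Rightarrow> nat \<Rightarrow> nat" where
  "degree_in E v = card {e \<in> E. v \<in> e}"

definition adjacency_matrix :: "nat \<Rightarrow> nat set set \<Rightarrow> real mat" where
  "adjacency_matrix n E = mat n n (\<lambda>(i, j). if {i, j} \<in> E then 1 else 0)"

text \<open>
  The eigenvalues are counted with multiplicity. Adjacency matrices are symmetric, so all roots of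
  the characteristic polynomial are real, and algebraic and geometric multiplicities agree.
\<close>

definition adjacency_spectrum :: "nat \<Rightarrow> nat set set \<Rightarrow> real multiset" where
  "adjacency_spectrum n E = proots (char_poly (adjacency_matrix n E))"

text \<open>
  The \<open>(n, (1 \<plusminus> \<gamma>)d, \<lambda>)\<close>-graphs. Only one copy of the largest eigenvalue is exempt from the bound.
\<close>

definition nearly_regular_spectral_graph ::
    "nat \<Rightarrow> real \<Rightarrow> real \<Rightarrow> real \<Rightarrow> nat set set \<Rightarrow> bool" where
  "nearly_regular_spectral_graph n \<gamma> d l E \<longleftrightarrow>
     simple_graph n E \<and> \<gamma> \<ge> 0 \<and>
     (\<forall>v<n. (1 - \<gamma>) * d \<le> real (degree_in E v) \<and> real (degree_in E v) \<le> (1 + \<gamma>) * d) \<and>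
     (\<forall>\<mu> \<in># adjacency_spectrum n E - {# Max_mset (adjacency_spectrum n E) #}. \<bar>\<mu>\<bar> \<le> l)"

definition cycle_edges :: "nat list \<Rightarrow> nat set set" where
  "cycle_edges vs = {{vs ! i, vs ! (Suc i mod length vs)} |i. i < length vs}"

text \<open>
  The list \<open>vs\<close> runs once around the cycle, so the length of the cycle is \<open>length vs\<close>.
\<close>

definition induced_cycle :: "nat \<Rightarrow> nat set set \<Rightarrow> nat list \<Rightarrow> bool" where
  "induced_cycle n E vs \<longleftrightarrow>
     length vs \<ge> 3 \<and> distinct vs \<and> set vs \<subseteq> {..<n} \<and>
     {e \<in> E. e \<subseteq> set vs} = cycle_edges vs"

end

theory Submission
  imports Defs "Jordan_Normal_Form.Spectral_Radius" "Jordan_Normal_Form.Schur_Decomposition"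
    "HOL-Analysis.L2_Norm"
begin

text \<open>
  Near-regularity makes the constant vector almost an eigenvector, so the adjacency matrix differs from
  \<open>d/n\<close> times the all-ones matrix by an operator of norm \<open>\<rho>d\<close>, where \<open>\<rho>\<close> is a power of \<open>\<lambda>/d\<close>.

  It suffices to find arbitrarily long walks without chords of length between 2 and \<open>K\<close>: a walk with more
  than \<open>n\<close> vertices has some chord, and a shortest one closes an induced cycle of length more than \<open>K\<close>.

  The number of such walks grows by a factor \<open>\<epsilon>d/2\<close> per step. To see this, each new vertex is required
  to be typical for the set \<open>U\<close> of vertices not adjacent to the current window, so that \<open>|U|\<close> shrinks by a
  factor of about \<open>1 - d/n\<close> per step and stays above \<open>\<epsilon>n\<close> for \<open>K\<close> of order \<open>(n/d) log(1/\<epsilon>)\<close>. If a prefix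
  of a walk is fixed, the distribution of the end of the walk approaches the uniform one in \<open>L2\<close> at rate
  \<open>\<rho>/\<epsilon>\<close>; summed over all prefixes, this uses only the growth of the total number of walks in earlier steps.
  By mixing, almost the proportion \<open>|U|/n\<close> of the one-step continuations then ends in \<open>U\<close>.
\<close>

section \<open>Spectral decomposition of real symmetric matrices\<close>

text \<open>The obstacle is that the vertices still allowed depend on the very steps that led to the
  end of the walk, so mixing cannot be applied to the whole walk at once. The walk is therefore
  split \<open>m\<close> vertices before its end. The prefix determines a set of allowed vertices,
  and \<open>m\<close> steps later the end has nearly forgotten the prefix. The last
  \<open>m\<close> vertices are charged separately, each for about a proportion \<open>d / n\<close>
  of the continuations. Fixing a prefix concentrates the next vertex on about d vertices, an L2
  excess of \<open>sqrt (n / d)\<close>; with geometric decay, \<open>m\<close> of that order is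
  ample, and the charge is then about \<open>sqrt (d / n)\<close>. This is negligible only if
  \<open>d / n\<close> is small; if it is at least \<open>\<epsilon> ^ 4\<close>, only the last
  vertex is split off. Decay and growth support each other: growth in all steps before length k
  gives decay at length k, and this gives growth from k to k + 1. With
  \<open>\<epsilon> ^ 30 = \<lambda> / d\<close> all losses of a step are multiples of
  \<open>\<epsilon> ^ 2\<close>, against a main term \<open>\<epsilon>\<close>.\<close>

lemma symmetric_real_eigenvector:
  fixes A :: "real mat"
  assumes A: "A \<in> carrier_mat n n" and sym: "A\<^sup>T = A" and n: "n > 0"
  shows "\<exists>e v. eigenvector A v e"
proof -
  let ?c = "complex_of_real"
  let ?B = "map_mat ?c A"
  have B: "?B \<in> carrier_mat n n" using A by simp
  obtain m where "eigenvalue ?B m"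
    using spectrum_non_empty[OF B] n unfolding spectrum_def by auto
  then obtain z where z: "z \<in> carrier_vec n" "z \<noteq> 0\<^sub>v n" and ev: "?B *\<^sub>v z = m \<cdot>\<^sub>v z"
    using B unfolding eigenvalue_def eigenvector_def by auto
  have symB: "A $$ (i,j) = A $$ (j,i)" if "i < n" "j < n" for i j
    using arg_cong[OF sym, of "\<lambda>M. M $$ (i,j)"] that A by auto
  have row: "(\<Sum>j<n. ?c (A $$ (i,j)) * z $ j) = m * z $ i" if "i < n" for i
    using arg_cong[OF ev, of "\<lambda>v. v $ i"] that A z
    by (auto simp: scalar_prod_def atLeast0LessThan intro!: sum.cong)
  define s where "s = (\<Sum>i<n. cnj (z $ i) * z $ i)"
  have s_real: "s = ?c (\<Sum>i<n. (cmod (z $ i))\<^sup>2)"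
    unfolding s_def of_real_sum
    by (intro sum.cong refl) (simp add: complex_norm_square[symmetric] mult.commute del: of_real_power)
  obtain i0 where i0: "i0 < n" "z $ i0 \<noteq> 0"
    using z by (metis carrier_vecD eq_vecI index_zero_vec(1) index_zero_vec(2))
  have "(\<Sum>i<n. (cmod (z $ i))\<^sup>2) > 0"
    using i0 by (intro sum_pos2[of _ i0]) auto
  then have s0: "s \<noteq> 0" unfolding s_real by (metis of_real_eq_0_iff less_irrefl)
  \<comment> \<open>The Hermitian form q of the real symmetric matrix at z is real, and q = m s with
    s the nonzero real squared norm of z; hence m is real.\<close>
  define q where "q = (\<Sum>i<n. \<Sum>j<n. cnj (z $ i) * ?c (A $$ (i,j)) * z $ j)"
  have q1: "q = m * s"
    unfolding q_def s_def sum_distrib_left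
    by (intro sum.cong refl) (simp add: mult.assoc sum_distrib_left[symmetric] row)
  have "cnj q = (\<Sum>i<n. \<Sum>j<n. z $ i * ?c (A $$ (i,j)) * cnj (z $ j))"
    unfolding q_def by simp
  also have "\<dots> = (\<Sum>j<n. \<Sum>i<n. z $ i * ?c (A $$ (i,j)) * cnj (z $ j))"
    by (rule sum.swap)
  also have "\<dots> = q"
    unfolding q_def by (intro sum.cong refl) (simp add: symB mult_ac)
  finally have "cnj q = q" .
  moreover have "cnj s = s" unfolding s_real by (simp only: complex_cnj_complex_of_real)
  ultimately have "cnj m = m" using q1 s0 by auto
  then have mr: "m = ?c (Re m)" by (metis Reals_cnj_iff of_real_Re)
  have "poly (char_poly ?B) m = 0"
    using \<open>eigenvalue ?B m\<close> eigenvalue_root_char_poly[OF B] by simp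
  then have "poly (map_poly ?c (char_poly A)) (?c (Re m)) = 0"
    using of_real_hom.char_poly_hom[OF A] mr by metis
  then have "poly (char_poly A) (Re m) = 0" by simp
  then show ?thesis
    using eigenvalue_root_char_poly[OF A] unfolding eigenvalue_def by blast
qed

text \<open>Gram-Schmidt leaves the first vector of its list unchanged, so it is run on a basis that
  starts with \<open>v\<close>; only the final normalisation rescales that vector.\<close>

lemma orthonormal_completion:
  fixes v :: "real vec"
  assumes v: "v \<in> carrier_vec n" and v0: "v \<noteq> 0\<^sub>v n" and n: "n > 0"
  shows "\<exists>W \<in> carrier_mat n n. W\<^sup>T * W = 1\<^sub>m n \<and> (\<exists>c. col W 0 = c \<cdot>\<^sub>v v)"
proof -
  interpret cof_vec_space n "TYPE(real)" .
  define b where "b = basis_completion v"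
  define ws where "ws = gram_schmidt n b"
  from basis_completion[OF v v0, folded b_def]
  have dist_b: "distinct b"
    and indep: "\<not> lin_dep (set b)" and b: "set b \<subseteq> carrier_vec n" and hdb: "hd b = v" 
    and len_b: "length b = n" by auto
  from hdb len_b n obtain vs where bv: "b = v # vs" by (cases b, auto)
  from gram_schmidt_result[OF b dist_b indep refl, folded ws_def]
  have ws: "set ws \<subseteq> carrier_vec n" "corthogonal ws" "length ws = n" 
    by (auto simp: len_b)
  from gram_schmidt_hd[OF v, of vs, folded bv] have hdws: "hd ws = v" unfolding ws_def .
  define us where "us = map (\<lambda>w. (1 / sqrt (w \<bullet> w)) \<cdot>\<^sub>v w) ws"
  define W where "W = mat_of_cols n us"
  have wc: "ws ! i \<in> carrier_vec n" if "i < n" for i using ws that by auto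
  have us: "us ! i = (1 / sqrt (ws ! i \<bullet> ws ! i)) \<cdot>\<^sub>v ws ! i" if "i < n" for i
    using that ws unfolding us_def by simp
  have W: "W \<in> carrier_mat n n" unfolding W_def us_def using ws(3) by auto
  have col: "col W i = us ! i" if "i < n" for i
    unfolding W_def using that ws wc[OF that] us[OF that] by (intro col_mat_of_cols) (auto simp: us_def)
  have real_conj: "conjugate x = x" if "x \<in> carrier_vec n" for x :: "real vec"
    using that by (intro eq_vecI) auto
  have orth: "ws ! i \<bullet> ws ! j = 0 \<longleftrightarrow> i \<noteq> j" if "i < n" "j < n" for i j
    using corthogonalD[OF ws(2)] ws(3) that real_conj[OF wc[OF that(2)]] by simp
  have "W\<^sup>T * W = 1\<^sub>m n"
  proof (rule eq_matI)
    fix i j assume ij: "i < dim_row (1\<^sub>m n)" "j < dim_col (1\<^sub>m n)"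
    then have ij: "i < n" "j < n" by auto
    have "(W\<^sup>T * W) $$ (i,j) = us ! i \<bullet> us ! j"
      using ij W col by simp
    also have "\<dots> = (1 / sqrt (ws ! i \<bullet> ws ! i)) * (1 / sqrt (ws ! j \<bullet> ws ! j)) * (ws ! i \<bullet> ws ! j)"
      using us ij wc[OF ij(1)] wc[OF ij(2)] by simp
    also have "\<dots> = (if i = j then 1 else 0)"
    proof (cases "i = j")
      case True
      have "ws ! i \<bullet> ws ! i \<noteq> 0" using orth[OF ij(1) ij(1)] by simp
      moreover have "ws ! i \<bullet> ws ! i \<ge> 0" by (simp add: scalar_prod_def sum_nonneg)
      ultimately show ?thesis using True by (simp add: field_simps)
    qed (simp add: orth ij)
    finally show "(W\<^sup>T * W) $$ (i,j) = 1\<^sub>m n $$ (i,j)" using ij by simp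
  qed (use W in auto)
  moreover have "col W 0 = (1 / sqrt (v \<bullet> v)) \<cdot>\<^sub>v v"
    using col[OF n] us[OF n] hdws ws(3) n by (metis hd_conv_nth length_0_conv less_not_refl)
  ultimately show ?thesis using W by blast
qed

text \<open>Deflation: in an orthonormal basis starting with an eigenvector the first column is
  \<open>e\<close> followed by zeros, symmetry clears the first row too, and the induction
  hypothesis diagonalises the remaining block.\<close>

theorem symmetric_diagonalization:
  fixes A :: "real mat"
  assumes "A \<in> carrier_mat n n" and "A\<^sup>T = A"
  shows "\<exists>W \<in> carrier_mat n n. \<exists>D \<in> carrier_mat n n. W\<^sup>T * W = 1\<^sub>m n \<and> diagonal_mat D \<and> W\<^sup>T * A * W = D"
  using assms
proof (induction n arbitrary: A)
  case 0
  then show ?case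
    by (intro bexI[of _ "1\<^sub>m 0"] bexI[of _ "0\<^sub>m 0 0"]) (auto simp: diagonal_mat_def intro!: eq_matI)
next
  case (Suc n A)
  let ?N = "Suc n"
  note A = Suc.prems(1)
  obtain e v where ev: "eigenvector A v e"
    using symmetric_real_eigenvector[OF Suc.prems] by auto
  then have v: "v \<in> carrier_vec ?N" "v \<noteq> 0\<^sub>v ?N" and Av: "A *\<^sub>v v = e \<cdot>\<^sub>v v"
    using A unfolding eigenvector_def by auto
  obtain W c where W: "W \<in> carrier_mat ?N ?N" and WW: "W\<^sup>T * W = 1\<^sub>m ?N" and col0: "col W 0 = c \<cdot>\<^sub>v v"
    using orthonormal_completion[OF v] by auto
  define B where "B = W\<^sup>T * A * W"
  have Wt: "W\<^sup>T \<in> carrier_mat ?N ?N" using W by simp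
  have B: "B \<in> carrier_mat ?N ?N" unfolding B_def using W A by simp
  have Bsym: "B\<^sup>T = B"
    unfolding B_def using W A Wt Suc.prems(2)
    by (simp add: transpose_mult[of _ ?N ?N _ ?N] assoc_mult_mat[of _ ?N ?N _ ?N _ ?N])
  have "A *\<^sub>v col W 0 = e \<cdot>\<^sub>v col W 0"
    unfolding col0 using A v Av
    by (metis mult_mat_vec smult_smult_assoc mult.commute)
  have Bi0: "B $$ (i, 0) = (if i = 0 then e else 0)" if i: "i < ?N" for i
  proof -
    have "B = W\<^sup>T * (A * W)" unfolding B_def using W A Wt by simp
    then have "B $$ (i,0) = row (W\<^sup>T) i \<bullet> col (A * W) 0" using i W A by simp
    also have "col (A * W) 0 = A *\<^sub>v col W 0" using A W by (intro col_mult2) auto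
    also have "\<dots> = e \<cdot>\<^sub>v col W 0" by fact
    also have "row (W\<^sup>T) i \<bullet> (e \<cdot>\<^sub>v col W 0) = e * (W\<^sup>T * W) $$ (i,0)"
      using i W by simp
    finally show ?thesis using i unfolding WW by simp
  qed
  have B0i: "B $$ (0, i) = (if i = 0 then e else 0)" if i: "i < ?N" for i
    using Bi0[OF i] arg_cong[OF Bsym, of "\<lambda>M. M $$ (0,i)"] B i by simp
  define C where "C = mat n n (\<lambda>(i,j). B $$ (Suc i, Suc j))"
  have C: "C \<in> carrier_mat n n" unfolding C_def by simp
  have "C\<^sup>T = C"
  proof (rule eq_matI)
    fix i j assume "i < dim_row C" "j < dim_col C"
    then show "C\<^sup>T $$ (i,j) = C $$ (i,j)"
      using arg_cong[OF Bsym, of "\<lambda>M. M $$ (Suc i,Suc j)"] B C unfolding C_def by simp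
  qed (auto simp: C_def)
  from Suc.IH[OF C this] obtain U D where U: "U \<in> carrier_mat n n" and D: "D \<in> carrier_mat n n"
    and UU: "U\<^sup>T * U = 1\<^sub>m n" and diag: "diagonal_mat D" and UCU: "U\<^sup>T * C * U = D" by auto
  let ?e = "mat 1 1 (\<lambda>_. e)"
  let ?z = "0\<^sub>m 1 n" and ?z' = "0\<^sub>m n 1"
  have Bblock: "B = four_block_mat ?e ?z ?z' C"
    using B C by (intro eq_matI) (auto simp: Bi0 B0i C_def)
  define V where "V = four_block_mat (1\<^sub>m 1) ?z ?z' U"
  define E where "E = four_block_mat ?e ?z ?z' D"
  have V: "V \<in> carrier_mat ?N ?N" using four_block_carrier_mat[OF one_carrier_mat[of 1] U] unfolding V_def by simp
  have E: "E \<in> carrier_mat ?N ?N" unfolding E_def using four_block_carrier_mat[of ?e 1 1 D] D by simp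
  have VT: "V\<^sup>T = four_block_mat (1\<^sub>m 1) ?z ?z' (U\<^sup>T)"
    unfolding V_def using U transpose_four_block_mat[of "1\<^sub>m 1" 1 1 ?z n ?z' n U] by (simp add: zero_transpose_mat)
  have Ut: "U\<^sup>T \<in> carrier_mat n n" using U by simp
  have VV: "V\<^sup>T * V = 1\<^sub>m ?N"
    unfolding VT unfolding V_def
    by (subst mult_four_block_mat[of _ 1 1 _ n _ n _ _ 1 _ n], (use U in auto), simp add: UU)
  have "V\<^sup>T * B = four_block_mat ?e ?z ?z' (U\<^sup>T * C)"
    unfolding VT Bblock
    by (subst mult_four_block_mat[of _ 1 1 _ n _ n _ _ 1 _ n], (use U C in auto))
  then have "V\<^sup>T * B * V = four_block_mat ?e ?z ?z' (U\<^sup>T * C) * V" by simp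
  also have "\<dots> = E"
    unfolding V_def E_def
    by (subst mult_four_block_mat[of _ 1 1 _ n _ n _ _ 1 _ n], (use U C UCU in auto))
  finally have VBV: "V\<^sup>T * B * V = E" .
  have "diagonal_mat E"
    using diag D unfolding E_def diagonal_mat_def by (auto simp: less_Suc_eq_0_disj) metis
  moreover have WV: "W * V \<in> carrier_mat ?N ?N" using W V by simp
  moreover have "(W * V)\<^sup>T * (W * V) = 1\<^sub>m ?N"
  proof -
    have "(W * V)\<^sup>T * (W * V) = V\<^sup>T * (W\<^sup>T * W) * V"
      using W V by (simp add: transpose_mult[of _ ?N ?N _ ?N] assoc_mult_mat[of _ ?N ?N _ ?N _ ?N])
    then show ?thesis using V WW VV by simp
  qed
  moreover have "(W * V)\<^sup>T * A * (W * V) = E"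
  proof -
    have "(W * V)\<^sup>T * A * (W * V) = V\<^sup>T * B * V"
      unfolding B_def using W V A
      by (simp add: transpose_mult[of _ ?N ?N _ ?N] assoc_mult_mat[of _ ?N ?N _ ?N _ ?N])
    then show ?thesis using VBV by simp
  qed
  ultimately show ?case using E by blast
qed

lemma proots_prod_linear: "proots (\<Prod>a\<leftarrow>es. [:- a, 1:]) = mset (es :: real list)"
proof (induction es)
  case (Cons a es)
  have "monic (\<Prod>a\<leftarrow>es. [:- a, 1:])" by (rule monic_prod_list) auto
  then have "(\<Prod>a\<leftarrow>es. [:- a, 1:]) \<noteq> 0" by auto
  then have "proots ([:- a, 1:] * (\<Prod>a\<leftarrow>es. [:- a, 1:])) = proots [:- a, 1:] + mset es"
    using Cons.IH by (subst proots_mult) auto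
  then show ?case by simp
qed simp

text \<open>\<open>u k\<close> is the k-th eigenvector. The first relation is orthonormality, the
  second completeness, which yields Parseval. The multiset equation makes indices correspond to
  eigenvalues with multiplicity, so that dropping one copy of an eigenvalue means dropping one
  index.\<close>

theorem symmetric_spectral_decomposition:
  fixes a :: "nat \<Rightarrow> nat \<Rightarrow> real"
  assumes sym: "\<And>i j. a i j = a j i"
  obtains u :: "nat \<Rightarrow> nat \<Rightarrow> real" and e :: "nat \<Rightarrow> real" where
    "\<And>k l. k < n \<Longrightarrow> l < n \<Longrightarrow> (\<Sum>i<n. u k i * u l i) = (if k = l then 1 else 0)"
    "\<And>i j. i < n \<Longrightarrow> j < n \<Longrightarrow> (\<Sum>k<n. u k i * u k j) = (if i = j then 1 else 0)"
    "\<And>i j. i < n \<Longrightarrow> j < n \<Longrightarrow> a i j = (\<Sum>k<n. e k * u k i * u k j)"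
    "proots (char_poly (mat n n (\<lambda>(i,j). a i j))) = image_mset e (mset_set {..<n})"
proof -
  define A where "A = mat n n (\<lambda>(i,j). a i j)"
  have A: "A \<in> carrier_mat n n" unfolding A_def by simp
  have "A\<^sup>T = A" unfolding A_def using sym by (intro eq_matI) auto
  from symmetric_diagonalization[OF A this] obtain W D where W: "W \<in> carrier_mat n n"
    and D: "D \<in> carrier_mat n n" and WW: "W\<^sup>T * W = 1\<^sub>m n" and diag: "diagonal_mat D"
    and WAW: "W\<^sup>T * A * W = D" by auto
  have Wt: "W\<^sup>T \<in> carrier_mat n n" using W by simp
  have WW': "W * W\<^sup>T = 1\<^sub>m n" using mat_mult_left_right_inverse[OF Wt W WW] .
  have AD: "A = W * D * W\<^sup>T"
  proof -
    have "W * D * W\<^sup>T = (W * W\<^sup>T) * A * (W * W\<^sup>T)"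
      unfolding WAW[symmetric] using W Wt A by (simp add: assoc_mult_mat[of _ n n _ n _ n])
    then show ?thesis unfolding WW' using A by simp
  qed
  define u where "u k i = W $$ (i,k)" for k i
  define e where "e k = D $$ (k,k)" for k
  have 1: "(\<Sum>i<n. u k i * u l i) = (if k = l then 1 else 0)" if "k < n" "l < n" for k l
  proof -
    have "(\<Sum>i<n. u k i * u l i) = (W\<^sup>T * W) $$ (k,l)"
      using that W by (auto simp: scalar_prod_def u_def atLeast0LessThan intro!: sum.cong)
    then show ?thesis using that by (simp add: WW)
  qed
  have 2: "(\<Sum>k<n. u k i * u k j) = (if i = j then 1 else 0)" if "i < n" "j < n" for i j
  proof -
    have "(\<Sum>k<n. u k i * u k j) = (W * W\<^sup>T) $$ (i,j)"
      using that W by (auto simp: scalar_prod_def u_def atLeast0LessThan intro!: sum.cong)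
    then show ?thesis using that by (simp add: WW')
  qed
  have WD: "(W * D) $$ (i,k) = W $$ (i,k) * D $$ (k,k)" if "i < n" "k < n" for i k
  proof -
    have "(W * D) $$ (i,k) = (\<Sum>l<n. W $$ (i,l) * D $$ (l,k))"
      using that W D by (auto simp: scalar_prod_def atLeast0LessThan intro!: sum.cong)
    also have "\<dots> = (\<Sum>l<n. if l = k then W $$ (i,k) * D $$ (k,k) else 0)"
      using diag D that unfolding diagonal_mat_def by (intro sum.cong) auto
    finally show ?thesis using that by simp
  qed
  have 3: "a i j = (\<Sum>k<n. e k * u k i * u k j)" if "i < n" "j < n" for i j
  proof -
    define X where "X = W * D"
    have X: "X \<in> carrier_mat n n" unfolding X_def using W D by simp
    have "a i j = (X * W\<^sup>T) $$ (i,j)" unfolding X_def AD[symmetric] using that by (simp add: A_def)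
    also have "\<dots> = (\<Sum>k<n. X $$ (i,k) * W $$ (j,k))"
      using that W X by (auto simp: scalar_prod_def atLeast0LessThan intro!: sum.cong)
    also have "\<dots> = (\<Sum>k<n. e k * u k i * u k j)"
      unfolding e_def u_def X_def using that WD by (intro sum.cong) auto
    finally show ?thesis .
  qed
  have "similar_mat_wit A D W (W\<^sup>T)"
    by (rule similar_mat_witI[of _ _ n]) (use W Wt A D WW WW' AD in auto)
  then have "char_poly A = char_poly D" using char_poly_similar unfolding similar_mat_def by blast
  also have "\<dots> = (\<Prod>a\<leftarrow>diag_mat D. [:- a, 1:])"
    using diag D by (intro char_poly_upper_triangular) (auto simp: diagonal_mat_def upper_triangular_def)
  finally have "proots (char_poly A) = mset (diag_mat D)" by (simp add: proots_prod_linear)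
  also have "\<dots> = image_mset e (mset_set {..<n})"
    using D unfolding diag_mat_def e_def by (simp add: atLeast0LessThan[symmetric] mset_upt[symmetric] del: mset_upt)
  finally have "proots (char_poly (mat n n (\<lambda>(i,j). a i j))) = image_mset e (mset_set {..<n})"
    unfolding A_def .
  from that[OF 1 2 3 this] show thesis .
qed

section \<open>Mixing in nearly regular graphs\<close>

lemma abs_sum_mult_le_L2: "\<bar>\<Sum>i\<in>A. f i * g i\<bar> \<le> L2_set f A * L2_set g A"
proof -
  have "\<bar>\<Sum>i\<in>A. f i * g i\<bar> \<le> (\<Sum>i\<in>A. \<bar>f i\<bar> * \<bar>g i\<bar>)"
    by (intro order_trans[OF sum_abs]) (simp add: abs_mult)
  also have "\<dots> \<le> L2_set f A * L2_set g A" by (rule L2_set_mult_ineq)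
  finally show ?thesis .
qed

text \<open>Here \<open>p\<close> stands for the normalised constant vector in eigenvector
  coordinates, and \<open>near\<close> says that it is an eigenvector for d up to an error of norm
  \<open>\<gamma> * d\<close>. All eigenvalues except \<open>e k0\<close> have distance at least d/2
  from d, so \<open>p\<close> must be concentrated on \<open>k0\<close>, and \<open>e k0\<close>
  must be close to d.\<close>

lemma diagonal_form_rank_one_perturbation:
  fixes e p F G :: "nat \<Rightarrow> real"
  assumes fin: "finite I" and k0: "k0 \<in> I"
    and p1: "(\<Sum>k\<in>I. (p k)\<^sup>2) = 1"
    and near: "(\<Sum>k\<in>I. (e k - d)\<^sup>2 * (p k)\<^sup>2) \<le> (\<gamma> * d)\<^sup>2"
    and small: "\<And>k. k \<in> I \<Longrightarrow> k \<noteq> k0 \<Longrightarrow> \<bar>e k\<bar> \<le> l"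
    and d: "d > 0" and l: "0 \<le> l" "l \<le> d / 2" and \<gamma>: "0 \<le> \<gamma>" "\<gamma> \<le> 1/4"
  shows "\<bar>(\<Sum>k\<in>I. e k * F k * G k) - d * (\<Sum>k\<in>I. p k * F k) * (\<Sum>k\<in>I. p k * G k)\<bar>
    \<le> (l + 8 * \<gamma> * d) * L2_set F I * L2_set G I"
proof -
  define J where "J = I - {k0}"
  have split: "sum h I = h k0 + sum h J" for h :: "nat \<Rightarrow> real"
    unfolding J_def using sum.remove[OF fin k0] by simp
  have finJ: "finite J" unfolding J_def using fin by simp
  define c where "c = p k0"
  define \<mu> where "\<mu> = e k0"
  define x where "x = L2_set F I"
  define y where "y = L2_set G I"
  have xy0: "x \<ge> 0" "y \<ge> 0" unfolding x_def y_def by simp_all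
  have nearJ: "(\<mu> - d)\<^sup>2 * c\<^sup>2 + (\<Sum>k\<in>J. (e k - d)\<^sup>2 * (p k)\<^sup>2) \<le> (\<gamma> * d)\<^sup>2"
    using near unfolding split \<mu>_def c_def .
  have "(\<Sum>k\<in>J. (d/2)\<^sup>2 * (p k)\<^sup>2) \<le> (\<Sum>k\<in>J. (e k - d)\<^sup>2 * (p k)\<^sup>2)"
  proof (intro sum_mono mult_right_mono)
    fix k assume "k \<in> J"
    then have "\<bar>e k\<bar> \<le> l" using small unfolding J_def by auto
    then have "d / 2 \<le> \<bar>e k - d\<bar>" using l by linarith
    then show "(d/2)\<^sup>2 \<le> (e k - d)\<^sup>2" using d by (metis abs_le_square_iff abs_of_pos half_gt_zero)
  qed simp
  moreover have "0 \<le> (\<mu> - d)\<^sup>2 * c\<^sup>2" by simp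
  ultimately have "(d/2)\<^sup>2 * (\<Sum>k\<in>J. (p k)\<^sup>2) \<le> (\<gamma> * d)\<^sup>2"
    using nearJ unfolding sum_distrib_left by linarith
  then have "d\<^sup>2 * (\<Sum>k\<in>J. (p k)\<^sup>2) \<le> d\<^sup>2 * (4 * \<gamma>\<^sup>2)" by (simp add: power_mult_distrib power_divide mult_ac)
  then have pJ: "(\<Sum>k\<in>J. (p k)\<^sup>2) \<le> 4 * \<gamma>\<^sup>2" using d by simp
  have c2: "c\<^sup>2 = 1 - (\<Sum>k\<in>J. (p k)\<^sup>2)" using p1 unfolding split c_def by simp
  have "\<gamma>\<^sup>2 \<le> \<gamma> * (1/4)" unfolding power2_eq_square using \<gamma> by (intro mult_left_mono) auto
  then have g2: "4 * \<gamma>\<^sup>2 \<le> \<gamma>" by simp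
  have "0 \<le> (\<Sum>k\<in>J. (p k)\<^sup>2)" by (simp add: sum_nonneg)
  then have c2b: "3/4 \<le> c\<^sup>2" "c\<^sup>2 \<le> 1" "\<bar>1 - c\<^sup>2\<bar> \<le> \<gamma>" using c2 pJ g2 \<gamma> by linarith+
  have c1: "\<bar>c\<bar> \<le> 1" using c2b(2) by (simp add: abs_square_le_1)
  have cmu: "\<bar>\<mu> - d\<bar> \<le> 2 * \<gamma> * d"
  proof -
    have "(\<mu> - d)\<^sup>2 * (1/4) \<le> (\<mu> - d)\<^sup>2 * c\<^sup>2" using c2b by (intro mult_left_mono) auto
    moreover have "0 \<le> (\<Sum>k\<in>J. (e k - d)\<^sup>2 * (p k)\<^sup>2)" by (simp add: sum_nonneg)
    ultimately have "(\<mu> - d)\<^sup>2 * (1/4) \<le> (\<gamma> * d)\<^sup>2" using nearJ by linarith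
    then have "(\<mu> - d)\<^sup>2 \<le> (2 * \<gamma> * d)\<^sup>2" by (simp add: power_mult_distrib)
    then show ?thesis using abs_le_square_iff[of "\<mu> - d" "2 * \<gamma> * d"] \<gamma> d by simp
  qed
  have subJ: "L2_set h J \<le> L2_set h I" for h :: "nat \<Rightarrow> real"
    unfolding L2_set_def split by simp
  have Fk: "\<bar>F k0\<bar> \<le> x" and Gk: "\<bar>G k0\<bar> \<le> y"
    unfolding x_def y_def L2_set_def split by (auto intro!: real_le_rsqrt sum_nonneg)
  have pJ': "L2_set p J \<le> 2 * \<gamma>"
    unfolding L2_set_def using pJ \<gamma> by (intro real_le_lsqrt) (auto simp: power_mult_distrib sum_nonneg)
  define f' where "f' = (\<Sum>k\<in>J. p k * F k)"
  define g' where "g' = (\<Sum>k\<in>J. p k * G k)"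
  have f': "\<bar>f'\<bar> \<le> 2 * \<gamma> * x"
    unfolding f'_def x_def using abs_sum_mult_le_L2[of p F J] pJ' subJ[of F] \<gamma>
    by (meson L2_set_nonneg mult_mono' order_trans)
  have g': "\<bar>g'\<bar> \<le> 2 * \<gamma> * y"
    unfolding g'_def y_def using abs_sum_mult_le_L2[of p G J] pJ' subJ[of G] \<gamma>
    by (meson L2_set_nonneg mult_mono' order_trans)
  have E: "\<bar>\<Sum>k\<in>J. e k * F k * G k\<bar> \<le> l * (x * y)"
  proof -
    have "\<bar>\<Sum>k\<in>J. e k * F k * G k\<bar> \<le> (\<Sum>k\<in>J. l * (\<bar>F k\<bar> * \<bar>G k\<bar>))"
    proof (intro order_trans[OF sum_abs] sum_mono)
      fix k assume "k \<in> J"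
      then have "\<bar>e k\<bar> \<le> l" using small unfolding J_def by auto
      then show "\<bar>e k * F k * G k\<bar> \<le> l * (\<bar>F k\<bar> * \<bar>G k\<bar>)"
        by (simp add: abs_mult mult.assoc mult_right_mono)
    qed
    also have "\<dots> \<le> l * (L2_set F J * L2_set G J)"
      unfolding sum_distrib_left[symmetric] using l by (intro mult_left_mono L2_set_mult_ineq)
    also have "\<dots> \<le> l * (x * y)"
      unfolding x_def y_def using l subJ by (intro mult_left_mono mult_mono) auto
    finally show ?thesis .
  qed
  \<comment> \<open>The four terms besides the sum over J are bounded by 3, 2, 2 and 1 times
    \<open>\<gamma> * d\<close>, up to the norms; this is the 8 in the claim. The last uses
    \<open>4 * \<gamma> ^ 2 \<le> \<gamma>\<close>.\<close>
  have "(\<Sum>k\<in>I. e k * F k * G k) - d * (\<Sum>k\<in>I. p k * F k) * (\<Sum>k\<in>I. p k * G k)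
     = (\<Sum>k\<in>J. e k * F k * G k) + (\<mu> - d * c\<^sup>2) * (F k0 * G k0)
       - d * (c * (F k0 * g')) - d * (c * (f' * G k0)) - d * (f' * g')"
    unfolding split \<mu>_def[symmetric] c_def[symmetric] f'_def[symmetric] g'_def[symmetric]
    by (simp add: algebra_simps power2_eq_square)
  also have "\<bar>\<dots>\<bar> \<le> l * (x * y) + (3 * \<gamma> * d) * (x * y) + d * (2 * \<gamma> * (x * y))
      + d * (2 * \<gamma> * (x * y)) + d * (\<gamma> * (x * y))"
  proof -
    have "\<bar>\<mu> - d * c\<^sup>2\<bar> \<le> \<bar>\<mu> - d\<bar> + \<bar>d * (1 - c\<^sup>2)\<bar>" by (simp add: algebra_simps)
    also have "\<bar>d * (1 - c\<^sup>2)\<bar> \<le> d * \<gamma>" using d c2b(3) by (simp add: abs_mult)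
    finally have "\<bar>\<mu> - d * c\<^sup>2\<bar> \<le> 3 * \<gamma> * d" using cmu by (simp add: algebra_simps)
    then have 1: "\<bar>(\<mu> - d * c\<^sup>2) * (F k0 * G k0)\<bar> \<le> (3 * \<gamma> * d) * (x * y)"
      unfolding abs_mult using Fk Gk xy0 \<gamma> d by (intro mult_mono) auto
    have "\<bar>c\<bar> * (\<bar>F k0\<bar> * \<bar>g'\<bar>) \<le> 1 * (x * (2 * \<gamma> * y))"
      using c1 Fk g' xy0 \<gamma> by (intro mult_mono) auto
    then have 2: "\<bar>d * (c * (F k0 * g'))\<bar> \<le> d * (2 * \<gamma> * (x * y))"
      unfolding abs_mult using d by (simp add: mult_ac)
    have "\<bar>c\<bar> * (\<bar>f'\<bar> * \<bar>G k0\<bar>) \<le> 1 * ((2 * \<gamma> * x) * y)"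
      using c1 Gk f' xy0 \<gamma> by (intro mult_mono) auto
    then have 3: "\<bar>d * (c * (f' * G k0))\<bar> \<le> d * (2 * \<gamma> * (x * y))"
      unfolding abs_mult using d by (simp add: mult_ac)
    have "\<bar>f'\<bar> * \<bar>g'\<bar> \<le> (2 * \<gamma> * x) * (2 * \<gamma> * y)"
      using f' g' xy0 \<gamma> by (intro mult_mono) auto
    also have "\<dots> = (4 * \<gamma>\<^sup>2) * (x * y)" by (simp add: power2_eq_square)
    also have "\<dots> \<le> \<gamma> * (x * y)" using g2 xy0 by (intro mult_right_mono) auto
    finally have 4: "\<bar>d * (f' * g')\<bar> \<le> d * (\<gamma> * (x * y))"
      unfolding abs_mult using d by simp
    show ?thesis using E 1 2 3 4 by linarith
  qed
  also have "\<dots> = (l + 8 * \<gamma> * d) * x * y" by (simp add: algebra_simps)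
  finally show ?thesis unfolding x_def y_def .
qed

text \<open>Expansion in an orthonormal eigenbasis makes the form diagonal and preserves inner
  products, so that the statement reduces to \<open>diagonal_form_rank_one_perturbation\<close> with
  the coordinates of the unit constant vector.\<close>

theorem near_regular_mixing:
  fixes a :: "nat \<Rightarrow> nat \<Rightarrow> real" and f g :: "nat \<Rightarrow> real"
  assumes sym: "\<And>i j. a i j = a j i" and n: "n > 0"
    and rows: "\<And>i. i < n \<Longrightarrow> \<bar>(\<Sum>j<n. a i j) - d\<bar> \<le> \<gamma> * d"
    and spec: "\<forall>\<mu> \<in># M - {# Max_mset M #}. \<bar>\<mu>\<bar> \<le> l"
    and M: "M = proots (char_poly (mat n n (\<lambda>(i,j). a i j)))"
    and d: "d > 0" and l: "0 \<le> l" "l \<le> d / 2" and \<gamma>: "0 \<le> \<gamma>" "\<gamma> \<le> 1/4"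
  shows "\<bar>(\<Sum>i<n. \<Sum>j<n. f i * a i j * g j) - d / n * (\<Sum>i<n. f i) * (\<Sum>i<n. g i)\<bar>
    \<le> (l + 8 * \<gamma> * d) * L2_set f {..<n} * L2_set g {..<n}"
proof -
  obtain u e where on: "\<And>k l. k < n \<Longrightarrow> l < n \<Longrightarrow> (\<Sum>i<n. u k i * u l i) = (if k = l then 1 else 0)"
    and cp: "\<And>i j. i < n \<Longrightarrow> j < n \<Longrightarrow> (\<Sum>k<n. u k i * u k j) = (if i = j then 1 else (0::real))"
    and a: "\<And>i j. i < n \<Longrightarrow> j < n \<Longrightarrow> a i j = (\<Sum>k<n. e k * u k i * u k j)"
    and pr: "proots (char_poly (mat n n (\<lambda>(i,j). a i j))) = image_mset e (mset_set {..<n})"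
    using symmetric_spectral_decomposition[of a n, OF sym] by blast
  define hat where "hat f k = (\<Sum>i<n. u k i * f i)" for f :: "nat \<Rightarrow> real" and k
  have form: "(\<Sum>i<n. \<Sum>j<n. f i * a i j * g j) = (\<Sum>k<n. e k * hat f k * hat g k)" for f g
  proof -
    have "(\<Sum>i<n. \<Sum>j<n. f i * a i j * g j) = (\<Sum>i<n. \<Sum>j<n. \<Sum>k<n. e k * (u k i * f i) * (u k j * g j))"
      by (intro sum.cong refl) (simp add: a sum_distrib_left sum_distrib_right mult_ac)
    also have "\<dots> = (\<Sum>i<n. \<Sum>k<n. \<Sum>j<n. e k * (u k i * f i) * (u k j * g j))"
      by (intro sum.cong refl sum.swap)
    also have "\<dots> = (\<Sum>k<n. \<Sum>i<n. \<Sum>j<n. e k * (u k i * f i) * (u k j * g j))"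
      by (rule sum.swap)
    also have "\<dots> = (\<Sum>k<n. e k * hat f k * hat g k)"
      unfolding hat_def by (simp add: sum_distrib_left sum_distrib_right mult_ac)
    finally show ?thesis .
  qed
  have parseval: "(\<Sum>k<n. hat f k * hat g k) = (\<Sum>i<n. f i * g i)" for f g
  proof -
    have "(\<Sum>k<n. hat f k * hat g k) = (\<Sum>k<n. \<Sum>i<n. \<Sum>j<n. (u k i * f i) * (u k j * g j))"
      unfolding hat_def by (simp add: sum_product)
    also have "\<dots> = (\<Sum>i<n. \<Sum>k<n. \<Sum>j<n. (u k i * f i) * (u k j * g j))"
      by (rule sum.swap)
    also have "\<dots> = (\<Sum>i<n. \<Sum>j<n. \<Sum>k<n. (u k i * f i) * (u k j * g j))"
      by (intro sum.cong refl sum.swap)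
    also have "\<dots> = (\<Sum>i<n. \<Sum>j<n. f i * g j * (\<Sum>k<n. u k i * u k j))"
      by (simp add: sum_distrib_left mult_ac)
    also have "\<dots> = (\<Sum>i<n. \<Sum>j<n. if j = i then f i * g j else 0)"
      by (intro sum.cong refl) (simp add: cp)
    finally show ?thesis by simp
  qed
  have L2: "L2_set (hat f) {..<n} = L2_set f {..<n}" for f
    using parseval[of f f] by (simp add: L2_set_def power2_eq_square)
  define I where "I = {..<n}"
  have M': "M = image_mset e (mset_set I)" unfolding M pr I_def ..
  have "M \<noteq> {#}" unfolding M' using n by (auto simp: I_def mset_set_empty_iff)
  then have "Max_mset M \<in># M" by simp
  then obtain k0 where k0: "k0 \<in> I" "Max_mset M = e k0" unfolding M' I_def by auto
  \<comment> \<open>Only one index is exempt from the bound \<open>l\<close>, even when the largest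
    eigenvalue is multiple.\<close>
  have "M - {# Max_mset M #} = image_mset e (mset_set (I - {k0}))"
    unfolding k0(2) unfolding M' using k0(1)
    by (simp add: I_def mset_set.remove[of "{..<n}" k0])
  then have small: "\<bar>e k\<bar> \<le> l" if "k \<in> I" "k \<noteq> k0" for k
    using spec that by (simp add: I_def)
  define o1 where "o1 = (\<lambda>i::nat. 1 / sqrt n)"
  have o1sq: "(\<Sum>k\<in>I. (hat o1 k)\<^sup>2) = 1"
    using parseval[of o1 o1] n by (simp add: I_def power2_eq_square o1_def)
  have near: "(\<Sum>k\<in>I. (e k - d)\<^sup>2 * (hat o1 k)\<^sup>2) \<le> (\<gamma> * d)\<^sup>2"
  proof -
    \<comment> \<open>\<open>r\<close> is A - d applied to the unit constant vector. Its entries are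
      the deviations of the row sums divided by \<open>sqrt n\<close>, so its norm is at most
      \<open>\<gamma> * d\<close>, and Parseval carries this to the coordinates.\<close>
    define r where "r i = (\<Sum>j<n. a i j * o1 j) - d * o1 i" for i
    have hatA: "hat (\<lambda>i. \<Sum>j<n. a i j * o1 j) k = e k * hat o1 k" if k: "k < n" for k
    proof -
      have "hat (\<lambda>i. \<Sum>j<n. a i j * o1 j) k = (\<Sum>i<n. \<Sum>j<n. u k i * a i j * o1 j)"
        unfolding hat_def by (simp add: sum_distrib_left mult_ac)
      also have "\<dots> = (\<Sum>l<n. e l * hat (u k) l * hat o1 l)" by (rule form)
      also have "\<dots> = (\<Sum>l<n. if l = k then e k * hat o1 k else 0)"
        using k unfolding hat_def by (intro sum.cong refl) (simp add: on)
      finally show ?thesis using k by simp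
    qed
    have hr: "hat r k = (e k - d) * hat o1 k" if k: "k < n" for k
    proof -
      have "hat r k = hat (\<lambda>i. \<Sum>j<n. a i j * o1 j) k - d * hat o1 k"
        unfolding r_def by (simp add: hat_def right_diff_distrib sum_subtractf sum_distrib_left mult_ac)
      then show ?thesis using hatA[OF k] by (simp add: algebra_simps)
    qed
    have "(\<Sum>k\<in>I. (e k - d)\<^sup>2 * (hat o1 k)\<^sup>2) = (\<Sum>k<n. hat r k * hat r k)"
      unfolding I_def by (intro sum.cong refl) (simp add: hr power2_eq_square)
    also have "\<dots> = (\<Sum>i<n. r i * r i)" by (rule parseval)
    also have "\<dots> \<le> (\<Sum>i<n. (\<gamma> * d)\<^sup>2 / n)"
    proof (rule sum_mono)
      fix i assume "i \<in> {..<n}"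
      then have "((\<Sum>j<n. a i j) - d)\<^sup>2 \<le> (\<gamma> * d)\<^sup>2"
        using rows[of i] \<gamma> d by (simp add: abs_le_square_iff[symmetric])
      moreover have "r i = ((\<Sum>j<n. a i j) - d) * (1 / sqrt n)"
        unfolding r_def o1_def by (simp add: left_diff_distrib sum_distrib_right sum_divide_distrib diff_divide_distrib)
      ultimately show "r i * r i \<le> (\<gamma> * d)\<^sup>2 / n"
        using n by (simp add: power2_eq_square divide_right_mono)
    qed
    finally show ?thesis using n by simp
  qed
  have so: "(\<Sum>k\<in>I. hat o1 k * hat h k) = (\<Sum>i<n. h i) / sqrt n" for h
    unfolding I_def parseval by (simp add: o1_def sum_divide_distrib)
  have "\<bar>(\<Sum>k\<in>I. e k * hat f k * hat g k) - d * (\<Sum>k\<in>I. hat o1 k * hat f k) * (\<Sum>k\<in>I. hat o1 k * hat g k)\<bar>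
    \<le> (l + 8 * \<gamma> * d) * L2_set (hat f) I * L2_set (hat g) I"
    by (rule diagonal_form_rank_one_perturbation[OF _ k0(1) o1sq near small d l \<gamma>]) (simp_all add: I_def)
  then show ?thesis
    unfolding so unfolding I_def form[symmetric] L2 using n by simp
qed

lemma degree_in_eq:
  assumes E: "simple_graph n E"
  shows "degree_in E v = card {j \<in> {..<n}. {v, j} \<in> E}"
proof -
  have "{e \<in> E. v \<in> e} = (\<lambda>j. {v, j}) ` {j \<in> {..<n}. {v, j} \<in> E}"
  proof (intro equalityI subsetI)
    fix e assume e: "e \<in> {e \<in> E. v \<in> e}"
    then obtain x y where xy: "e = {x, y}" "x \<noteq> y" and sub: "e \<subseteq> {..<n}"
      using E unfolding simple_graph_def by (auto simp: card_2_iff)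
    then have "e = {v, x} \<or> e = {v, y}" using e by auto
    then show "e \<in> (\<lambda>j. {v, j}) ` {j \<in> {..<n}. {v, j} \<in> E}" using e xy sub by auto
  qed auto
  moreover have "inj_on (\<lambda>j. {v, j}) {j \<in> {..<n}. {v, j} \<in> E}"
    by (auto simp: inj_on_def doubleton_eq_iff)
  ultimately show ?thesis unfolding degree_in_def by (simp add: card_image)
qed

lemma simple_graph_irrefl: "simple_graph n E \<Longrightarrow> {v, v} \<notin> E"
  unfolding simple_graph_def by auto

lemma spectral_graph_mixing:
  fixes f g :: "nat \<Rightarrow> real" and d :: nat and \<gamma> l :: real
  assumes G: "nearly_regular_spectral_graph n \<gamma> d l E" and n: "n > 0" and d: "d > 0"
    and l: "0 \<le> l" "l \<le> d / 2" and \<gamma>: "\<gamma> \<le> 1/4"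
  shows "\<bar>(\<Sum>x<n. \<Sum>y<n. f x * of_bool ({x, y} \<in> E) * g y) - d / n * (\<Sum>x<n. f x) * (\<Sum>y<n. g y)\<bar>
    \<le> (l + 8 * \<gamma> * d) * L2_set f {..<n} * L2_set g {..<n}"
proof (rule near_regular_mixing[where a = "\<lambda>x y. of_bool ({x, y} \<in> E)"])
  note G' = G[unfolded nearly_regular_spectral_graph_def]
  fix i assume i: "i < n"
  have "(\<Sum>j<n. of_bool ({i, j} \<in> E)) = real (degree_in E i)"
    unfolding degree_in_eq[OF conjunct1[OF G']] by (simp add: of_bool_def sum.If_cases Int_def conj_commute)
  then show "\<bar>(\<Sum>j<n. of_bool ({i, j} \<in> E)) - real d\<bar> \<le> \<gamma> * d"
    using G' i by (auto simp: abs_le_iff algebra_simps)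
next
  show "\<forall>\<mu>\<in>#adjacency_spectrum n E - {#Max_mset (adjacency_spectrum n E)#}. \<bar>\<mu>\<bar> \<le> l"
    using G unfolding nearly_regular_spectral_graph_def by blast
  show "adjacency_spectrum n E = proots (char_poly (mat n n (\<lambda>(i, j). of_bool ({i, j} \<in> E))))"
    unfolding adjacency_spectrum_def adjacency_matrix_def of_bool_def ..
qed (use G assms in \<open>auto simp: insert_commute nearly_regular_spectral_graph_def\<close>)

text \<open>The bound comes from testing the mixing inequality on a vertex and its neighbourhood.\<close>

lemma mixing_parameter_lower_bound:
  fixes d :: nat and \<alpha> s :: real
  assumes E: "simple_graph n E" and v: "v < n" and dn: "real d \<le> \<alpha> * n" and d: "d > 0"
    and deg: "real d / 2 \<le> degree_in E v" and s: "s \<ge> 0" and \<alpha>: "\<alpha> < 1"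
    and mix: "\<And>f g. \<bar>(\<Sum>x<n. \<Sum>y<n. f x * of_bool ({x, y} \<in> E) * g y) - d / n * (\<Sum>x<n. f x) * (\<Sum>y<n. g y)\<bar>
      \<le> s * d * L2_set f {..<n} * L2_set g {..<n}"
  shows "(1 - \<alpha>)\<^sup>2 / 2 \<le> s\<^sup>2 * d"
proof -
  define D where "D = real (degree_in E v)"
  define f where "f x = (of_bool (x = v) :: real)" for x
  define g where "g y = (of_bool ({v, y} \<in> E) :: real)" for y
  have D0: "D > 0" using deg d unfolding D_def by simp
  have sf: "(\<Sum>x<n. f x) = 1" using v by (simp add: f_def of_bool_def)
  have lf: "L2_set f {..<n} = 1" using v by (simp add: f_def L2_set_def of_bool_def if_distrib[of "\<lambda>x. x\<^sup>2"] cong: if_cong)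
  have sg: "(\<Sum>y<n. g y) = D"
    unfolding D_def degree_in_eq[OF E] g_def by (simp add: of_bool_def sum.If_cases Int_def conj_commute)
  have "(\<Sum>y<n. (g y)\<^sup>2) = (\<Sum>y<n. g y)" by (intro sum.cong refl) (simp add: g_def)
  then have lg: "L2_set g {..<n} = sqrt D" unfolding L2_set_def sg by simp
  have "(\<Sum>x<n. \<Sum>y<n. f x * of_bool ({x, y} \<in> E) * g y) = (\<Sum>x<n. if x = v then (\<Sum>y<n. g y) else 0)"
    by (intro sum.cong refl) (auto simp: f_def g_def intro!: sum.cong)
  also have "\<dots> = D" using v sg by simp
  finally have "\<bar>D - d / n * D\<bar> \<le> s * d * sqrt D" using mix[of f g] sf lf lg sg by simp
  moreover have "(1 - \<alpha>) * D \<le> D - d / n * D"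
  proof -
    have "real d / n \<le> \<alpha>" using dn v by (simp add: divide_le_eq)
    then have "d / n * D \<le> \<alpha> * D" using D0 by (intro mult_right_mono) auto
    then show ?thesis by (simp add: algebra_simps)
  qed
  ultimately have "(1 - \<alpha>) * D \<le> s * d * sqrt D" by linarith
  then have "((1 - \<alpha>) * sqrt D) * sqrt D \<le> (s * d) * sqrt D" using D0 by (simp add: mult.assoc)
  then have "(1 - \<alpha>) * sqrt D \<le> s * d" using D0 by (simp add: mult_le_cancel_right)
  then have "((1 - \<alpha>) * sqrt D)\<^sup>2 \<le> (s * d)\<^sup>2" using \<alpha> D0 by (intro power_mono) auto
  moreover have "((1 - \<alpha>) * sqrt D)\<^sup>2 = (1 - \<alpha>)\<^sup>2 * D" using D0 by (simp add: power_mult_distrib)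
  moreover have "(s * d)\<^sup>2 = s\<^sup>2 * d * d" by (simp add: power2_eq_square)
  ultimately have "(1 - \<alpha>)\<^sup>2 * D \<le> s\<^sup>2 * d * d" by simp
  moreover have "(1 - \<alpha>)\<^sup>2 * (d / 2) \<le> (1 - \<alpha>)\<^sup>2 * D" using deg unfolding D_def by (intro mult_left_mono) auto
  ultimately have "((1 - \<alpha>)\<^sup>2 / 2) * d \<le> (s\<^sup>2 * d) * d" by simp
  then show ?thesis by (rule mult_right_le_imp_le) (use d in simp)
qed

section \<open>Induced cycles from locally induced walks\<close>

text \<open>Reduces the equality of edge sets to index pairs a < b; the pair (0, last) is the one at
  which the modulus in \<open>cycle_edges\<close> wraps around.\<close>

lemma induced_cycleI:
  assumes E: "simple_graph n E" and m: "length vs \<ge> 3" and dist: "distinct vs" and sub: "set vs \<subseteq> {..<n}"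
    and adj: "\<And>a b. a < b \<Longrightarrow> b < length vs \<Longrightarrow>
      {vs ! a, vs ! b} \<in> E \<longleftrightarrow> b = Suc a \<or> (a = 0 \<and> Suc b = length vs)"
  shows "induced_cycle n E vs"
proof -
  let ?m = "length vs"
  have "{e \<in> E. e \<subseteq> set vs} = cycle_edges vs"
  proof (intro equalityI subsetI)
    fix e assume "e \<in> {e \<in> E. e \<subseteq> set vs}"
    then have e: "e \<in> E" "e \<subseteq> set vs" by auto
    then obtain x y where xy: "e = {x,y}" "x \<noteq> y" using E unfolding simple_graph_def by (auto simp: card_2_iff)
    have main: "\<exists>i<?m. e = {vs ! i, vs ! (Suc i mod ?m)}"
      if "a < b" "b < ?m" "e = {vs ! a, vs ! b}" for a b
    proof -
      from adj[OF that(1,2)] e(1) that(3) consider "b = Suc a" | "a = 0" "Suc b = ?m" by auto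
      then show ?thesis
      proof cases
        case 1
        then show ?thesis using that by (intro exI[of _ a]) auto
      next
        case 2
        then show ?thesis using that by (intro exI[of _ b]) (auto simp: insert_commute)
      qed
    qed
    obtain a b where ab: "a < ?m" "b < ?m" "vs ! a = x" "vs ! b = y"
      using e(2) xy(1) by (metis in_set_conv_nth insert_subset)
    then have "a \<noteq> b" using xy(2) by auto
    then have "\<exists>i<?m. e = {vs ! i, vs ! (Suc i mod ?m)}"
      using main[of a b] main[of b a] ab xy(1) by (metis insert_commute nat_neq_iff)
    then show "e \<in> cycle_edges vs" unfolding cycle_edges_def by auto
  next
    fix e assume "e \<in> cycle_edges vs"
    then obtain i where i: "i < ?m" "e = {vs ! i, vs ! (Suc i mod ?m)}" unfolding cycle_edges_def by auto
    show "e \<in> {e \<in> E. e \<subseteq> set vs}"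
    proof (cases "Suc i = ?m")
      case True
      then have "e = {vs ! 0, vs ! i}" using i by auto
      moreover have "vs ! 0 \<in> set vs" using m by (intro nth_mem) linarith
      ultimately show ?thesis using adj[of 0 i] True m i by auto
    next
      case False
      then have "e = {vs ! i, vs ! Suc i}" using i by simp
      then show ?thesis using adj[of i "Suc i"] False i by auto
    qed
  qed
  then show ?thesis unfolding induced_cycle_def using m dist sub by blast
qed

text \<open>A coincidence of two vertices counts as a chord, so pigeonhole on the first n + 1
  vertices provides one. Minimality of \<open>t\<close> excludes every other chord between the two
  ends, and \<open>far\<close> makes \<open>t\<close> exceed K.\<close>

lemma long_locally_induced_walk_imp_induced_cycle:
  assumes E: "simple_graph n E" and K: "K \<ge> 3" and L: "length P \<ge> n + 2" and sub: "set P \<subseteq> {..<n}"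
    and step: "\<And>i. Suc i < length P \<Longrightarrow> P ! i = P ! Suc i \<or> {P ! i, P ! Suc i} \<in> E"
    and far: "\<And>i k. i + 2 \<le> k \<Longrightarrow> k \<le> i + K \<Longrightarrow> k < length P \<Longrightarrow>
       P ! i \<noteq> P ! k \<and> {P ! i, P ! k} \<notin> E"
  shows "\<exists>vs. induced_cycle n E vs \<and> length vs > K"
proof -
  have "P ! 0 \<in> {..<n}" using sub L by (intro subsetD[OF sub] nth_mem) linarith
  then have n: "n \<ge> 1" by simp
  define C where "C x y \<longleftrightarrow> x = y \<or> {x, y} \<in> E" for x y
  have step': "C (P ! i) (P ! Suc i)" if "Suc i < length P" for i using step[OF that] unfolding C_def by auto
  have far': "\<not> C (P ! i) (P ! k)" if "i + 2 \<le> k" "k \<le> i + K" "k < length P" for i k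
    using far[OF that] unfolding C_def by auto
  \<comment> \<open>Standing still would relate the pair to a vertex two positions away, contrary to
    \<open>far\<close>. The walk has at least n + 2 \<ge> 3 vertices, so there is such a vertex
    after the pair or, at the end of the walk, before it.\<close>
  have neq: "P ! i \<noteq> P ! Suc i" if "Suc i < length P" for i
  proof
    assume eq: "P ! i = P ! Suc i"
    show False
    proof (cases "Suc (Suc i) < length P")
      case True
      then show False using step'[OF True] far'[of i "Suc (Suc i)"] eq K by auto
    next
      case False
      then have "i \<ge> 1" using L n that by linarith
      then have "\<not> C (P ! (i - 1)) (P ! Suc i)" using K that by (intro far') arith+
      then show False using step'[of "i - 1"] eq that \<open>i \<ge> 1\<close> by auto
    qed
  qed
  define chord where "chord t \<longleftrightarrow> t \<ge> 2 \<and> (\<exists>i. i + t < length P \<and> C (P ! i) (P ! (i + t)))" for t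
  have "\<not> inj_on (\<lambda>i. P ! i) {..n}"
  proof
    assume "inj_on (\<lambda>i. P ! i) {..n}"
    moreover have "(\<lambda>i. P ! i) ` {..n} \<subseteq> {..<n}" using sub L by (force simp: subset_iff)
    ultimately have "card {..n} \<le> card {..<n}" by (intro card_inj_on_le) auto
    then show False by simp
  qed
  then obtain i k where ik: "i < k" "k \<le> n" "P ! i = P ! k"
    unfolding inj_on_def by (metis atMost_iff nat_neq_iff)
  have "k \<noteq> Suc i" using neq[of i] ik L by auto
  then have "chord (k - i)" unfolding chord_def C_def using ik L by (auto intro!: exI[of _ i])
  define t where "t = (LEAST t. chord t)"
  have t: "chord t" unfolding t_def by (rule LeastI) fact
  have tmin: "\<not> chord s" if "s < t" for s using that unfolding t_def by (rule not_less_Least)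
  obtain i where i: "i + t < length P" "C (P ! i) (P ! (i + t))" and t2: "t \<ge> 2" using t unfolding chord_def by auto
  have tK: "t > K" using far'[of i "i + t"] i t2 by force
  \<comment> \<open>If the shortest chord were a coincidence, the vertex before its end would be
    related to its start. This chord of length \<open>t - 1\<close> is still admissible, as
    \<open>t > K \<ge> 3\<close>.\<close>
  have neqe: "P ! i \<noteq> P ! (i + t)"
  proof
    assume eq: "P ! i = P ! (i + t)"
    have "C (P ! (i + (t - 1))) (P ! (i + t))" using step'[of "i + (t - 1)"] i t2 by simp
    then have "chord (t - 1)" unfolding chord_def using i tK K eq
      by (auto simp: C_def insert_commute intro!: exI[of _ i])
    then show False using tmin[of "t - 1"] t2 by simp
  qed
  have inner: "\<not> C (P ! a) (P ! b)" if "a + 2 \<le> b" "b - a < t" "b < length P" for a b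
  proof
    assume "C (P ! a) (P ! b)"
    then have "chord (b - a)" unfolding chord_def using that by (intro conjI exI[of _ a]) auto
    then show False using tmin[OF that(2)] by blast
  qed
  define vs where "vs = map (\<lambda>a. P ! (i + a)) [0..<Suc t]"
  have len: "length vs = Suc t" unfolding vs_def by simp
  have nth: "vs ! a = P ! (i + a)" if "a < Suc t" for a using that unfolding vs_def by (metis add_0 diff_zero length_upt nth_map nth_upt)
  have key: "vs ! a \<noteq> vs ! b \<and> ({vs ! a, vs ! b} \<in> E \<longleftrightarrow> b = Suc a \<or> (a = 0 \<and> b = t))"
    if "a < b" "b < Suc t" for a b
  proof -
    have "b = Suc a \<or> (a = 0 \<and> b = t) \<or> (a + 2 \<le> b \<and> b - a < t)" using that by arith
    then consider "b = Suc a" | "a = 0" "b = t" | "a + 2 \<le> b" "b - a < t" by blast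
    then show ?thesis
    proof cases
      case 1
      then show ?thesis using neq[of "i + a"] step[of "i + a"] that i by (auto simp: nth)
    next
      case 2
      then show ?thesis using neqe i(2) by (auto simp: nth C_def)
    next
      case 3
      then have "\<not> C (P ! (i + a)) (P ! (i + b))" using that i by (intro inner) auto
      then show ?thesis using 3 that by (auto simp: nth C_def)
    qed
  qed
  have "distinct vs" unfolding distinct_conv_nth len using key by (metis nat_neq_iff)
  moreover have "set vs \<subseteq> {..<n}" unfolding vs_def using sub i by (fastforce simp: subset_iff)
  ultimately have "induced_cycle n E vs"
    using key tK K by (intro induced_cycleI[OF E]) (auto simp: len)
  then show ?thesis using len tK by (intro exI[of _ vs]) auto
qed

section \<open>Counting locally induced walks\<close>

text \<open>\<open>C\<close> will be "adjacent or equal", so that one relation rules out both chords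
  and repeated vertices. The identity adds one to every degree, which the bound \<open>3 * d\<close>
  leaves room for, and a summand of norm one to the error, which \<open>\<rho>\<close> has to
  absorb.\<close>

locale mixing_relation =
  fixes V :: "'a set" and C :: "'a \<Rightarrow> 'a \<Rightarrow> bool" and d \<rho> :: real
  assumes finV: "finite V" and neV: "V \<noteq> {}" and d_pos: "d > 0" and rho_nonneg: "\<rho> \<ge> 0"
    and deg: "x \<in> V \<Longrightarrow> real (card {y \<in> V. C x y}) \<le> 3 * d"
    and mixing: "\<bar>(\<Sum>x\<in>V. \<Sum>y\<in>V. f x * of_bool (C x y) * g y)
        - d / card V * (\<Sum>x\<in>V. f x) * (\<Sum>y\<in>V. g y)\<bar> \<le> \<rho> * d * L2_set f V * L2_set g V"
begin

definition n :: real where "n = real (card V)"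

lemma n_pos: "n > 0" unfolding n_def using finV neV by (simp add: card_gt_0_iff)

lemma sum_of_bool: "A \<subseteq> V \<Longrightarrow> (\<Sum>x\<in>V. of_bool (x \<in> A)) = real (card A)"
proof -
  assume A: "A \<subseteq> V"
  have "(\<Sum>x\<in>V. of_bool (x \<in> A)) = (\<Sum>x\<in>A. 1 :: real)"
    using finV A by (intro sum.mono_neutral_cong_right) auto
  then show ?thesis by simp
qed

lemma L2_of_bool: "A \<subseteq> V \<Longrightarrow> L2_set (\<lambda>x. of_bool (x \<in> A)) V = sqrt (card A)"
proof -
  assume A: "A \<subseteq> V"
  have "(\<Sum>x\<in>V. (of_bool (x \<in> A))\<^sup>2) = (\<Sum>x\<in>V. of_bool (x \<in> A) :: real)"
    by (intro sum.cong refl) auto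
  then show ?thesis using sum_of_bool[OF A] by (simp add: L2_set_def)
qed

lemma card_eq_sum: "real (card {w \<in> V. P w}) = (\<Sum>w\<in>V. of_bool (P w))"
proof -
  have "(\<Sum>w\<in>V. of_bool (P w)) = (\<Sum>w\<in>V. of_bool (w \<in> {w \<in> V. P w}) :: real)"
    by (intro sum.cong refl) auto
  then show ?thesis using sum_of_bool[of "{w \<in> V. P w}"] by simp
qed

lemma mixing_set:
  assumes Y: "Y \<subseteq> V" and f: "\<And>x. x \<in> V \<Longrightarrow> f x \<ge> 0"
  shows "\<bar>(\<Sum>x\<in>V. f x * real (card {w \<in> Y. C x w})) - d / n * (\<Sum>x\<in>V. f x) * card Y\<bar>
    \<le> \<rho> * d * (L2_set f V * sqrt (card Y))"
proof -
  have "(\<Sum>x\<in>V. f x * real (card {w \<in> Y. C x w}))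
     = (\<Sum>x\<in>V. \<Sum>y\<in>V. f x * of_bool (C x y) * of_bool (y \<in> Y))"
  proof (intro sum.cong refl)
    fix x
    have "{w \<in> Y. C x w} = {w \<in> V. C x w \<and> w \<in> Y}" using Y by auto
    then show "f x * real (card {w \<in> Y. C x w}) = (\<Sum>y\<in>V. f x * of_bool (C x y) * of_bool (y \<in> Y))"
      by (simp add: card_eq_sum sum_distrib_left of_bool_conj mult_ac)
  qed
  then show ?thesis
    using mixing[of f "\<lambda>y. of_bool (y \<in> Y)"] by (simp add: sum_of_bool[OF Y] L2_of_bool[OF Y] n_def mult_ac)
qed

text \<open>Duality: mixing is tested with the pushed-forward function as its own partner. Its sum
  is at most \<open>sqrt n\<close> times its norm by Cauchy-Schwarz, and one factor of the norm
  cancels.\<close>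

lemma L2_step:
  assumes f: "\<And>x. x \<in> V \<Longrightarrow> f x \<ge> 0"
  shows "L2_set (\<lambda>y. \<Sum>x\<in>V. f x * of_bool (C x y)) V \<le> d / sqrt n * (\<Sum>x\<in>V. f x) + \<rho> * d * L2_set f V"
proof -
  define F where "F y = (\<Sum>x\<in>V. f x * of_bool (C x y))" for y
  define l where "l = L2_set F V"
  have F0: "F y \<ge> 0" if "y \<in> V" for y unfolding F_def using f by (intro sum_nonneg) auto
  have l0: "l \<ge> 0" unfolding l_def by simp
  have "l\<^sup>2 = (\<Sum>y\<in>V. F y * F y)"
    unfolding l_def L2_set_def by (simp add: sum_nonneg power2_eq_square)
  also have "\<dots> = (\<Sum>y\<in>V. \<Sum>x\<in>V. f x * of_bool (C x y) * F y)"
    by (subst (1) F_def) (simp only: sum_distrib_right)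
  also have "\<dots> = (\<Sum>x\<in>V. \<Sum>y\<in>V. f x * of_bool (C x y) * F y)" by (rule sum.swap)
  also have "\<dots> \<le> d / n * (\<Sum>x\<in>V. f x) * (\<Sum>y\<in>V. F y) + \<rho> * d * L2_set f V * l"
    using mixing[of f F] unfolding l_def n_def by linarith
  finally have "l\<^sup>2 \<le> d / n * (\<Sum>x\<in>V. f x) * (\<Sum>y\<in>V. F y) + \<rho> * d * L2_set f V * l" .
  moreover have "(\<Sum>y\<in>V. F y) \<le> sqrt n * l"
    using L2_set_mult_ineq[of "\<lambda>_. 1" F V] F0 sum_of_bool[of V]
    unfolding l_def n_def by (simp add: L2_set_def of_bool_def cong: sum.cong)
  then have "d / n * (\<Sum>x\<in>V. f x) * (\<Sum>y\<in>V. F y) \<le> d / n * (\<Sum>x\<in>V. f x) * (sqrt n * l)"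
    using d_pos n_pos f by (intro mult_left_mono mult_nonneg_nonneg sum_nonneg) auto
  ultimately have "l\<^sup>2 \<le> d / n * (\<Sum>x\<in>V. f x) * (sqrt n * l) + \<rho> * d * L2_set f V * l" by linarith
  also have "\<dots> = (d / sqrt n * (\<Sum>x\<in>V. f x) + \<rho> * d * L2_set f V) * l"
    using n_pos by (simp add: field_simps)
  finally have *: "l * l \<le> (d / sqrt n * (\<Sum>x\<in>V. f x) + \<rho> * d * L2_set f V) * l"
    by (simp add: power2_eq_square)
  have "0 \<le> d / sqrt n * (\<Sum>x\<in>V. f x) + \<rho> * d * L2_set f V"
    using d_pos n_pos rho_nonneg f by (intro add_nonneg_nonneg mult_nonneg_nonneg sum_nonneg) auto
  then have "l \<le> d / sqrt n * (\<Sum>x\<in>V. f x) + \<rho> * d * L2_set f V"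
    using * l0 by (cases "l = 0") auto
  then show ?thesis unfolding l_def F_def .
qed

definition atypical :: "real \<Rightarrow> 'a set \<Rightarrow> 'a set" where
  "atypical \<theta> W = {w \<in> V. real (card {y \<in> W. C w y}) > (1 + \<theta>) * (d / n) * card W}"

text \<open>The atypical set sends to \<open>W\<close> the factor \<open>1 + \<theta>\<close> more
  than the expected number of pairs. Mixing bounds this excess by the geometric mean of the two
  sizes; solving for the size of the atypical set gives the bound.\<close>

lemma card_atypical:
  fixes \<theta> :: real
  assumes W: "W \<subseteq> V" and \<theta>: "\<theta> > 0" and W0: "card W > 0"
  shows "card (atypical \<theta> W) \<le> \<rho>\<^sup>2 * n\<^sup>2 / (\<theta>\<^sup>2 * card W)"
proof -
  define B where "B = atypical \<theta> W"
  have B: "B \<subseteq> V" unfolding B_def atypical_def by auto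
  define b where "b = real (card B)"
  define w where "w = real (card W)"
  have w: "w > 0" unfolding w_def using W0 by simp
  have b0: "b \<ge> 0" unfolding b_def by simp
  have "(1 + \<theta>) * (d / n) * w * b = (\<Sum>x\<in>B. (1 + \<theta>) * (d / n) * w)" unfolding b_def by simp
  also have "\<dots> \<le> (\<Sum>x\<in>B. real (card {y \<in> W. C x y}))"
    unfolding B_def atypical_def w_def by (intro sum_mono) auto
  also have "\<dots> = (\<Sum>x\<in>V. of_bool (x \<in> B) * real (card {y \<in> W. C x y}))"
    using B finV by (intro sum.mono_neutral_cong_left) auto
  also have "\<dots> \<le> d / n * b * w + \<rho> * d * (sqrt b * sqrt w)"
    using mixing_set[OF W, of "\<lambda>x. of_bool (x \<in> B)"] unfolding sum_of_bool[OF B] L2_of_bool[OF B] b_def w_def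
    by simp
  finally have "(1 + \<theta>) * (d / n) * w * b \<le> d / n * b * w + \<rho> * d * (sqrt b * sqrt w)" .
  moreover have "(1 + \<theta>) * (d / n) * w * b = d / n * b * w + d * (\<theta> / n * w * b)"
    using n_pos by (simp add: field_simps)
  ultimately have "d * (\<theta> / n * w * b) \<le> d * (\<rho> * (sqrt b * sqrt w))" by (simp add: mult_ac)
  then have "\<theta> / n * w * b \<le> \<rho> * (sqrt b * sqrt w)" by (rule mult_left_le_imp_le[OF _ d_pos])
  then have "(\<theta> / n * w * b)\<^sup>2 \<le> (\<rho> * (sqrt b * sqrt w))\<^sup>2"
    using \<theta> w b0 n_pos by (intro power_mono) auto
  then have "(\<theta>\<^sup>2 * w / n\<^sup>2 * b) * (b * w) \<le> \<rho>\<^sup>2 * (b * w)"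
    using b0 w by (simp add: power_mult_distrib power_divide power2_eq_square mult_ac)
  then have "b = 0 \<or> \<theta>\<^sup>2 * w / n\<^sup>2 * b \<le> \<rho>\<^sup>2"
    using b0 w mult_right_le_imp_le[of "\<theta>\<^sup>2 * w / n\<^sup>2 * b" "b * w" "\<rho>\<^sup>2"]
    by (metis less_eq_real_def mult_pos_pos)
  then have "b * (\<theta>\<^sup>2 * w) \<le> \<rho>\<^sup>2 * n\<^sup>2"
    using n_pos by (auto simp: field_simps)
  then show ?thesis using \<theta> w unfolding b_def w_def B_def by (simp add: field_simps)
qed

end

text \<open>The exponent \<open>2 * K\<close> in \<open>K_le\<close> is the maximal length of a
  window, two blocks. In \<open>\<rho> = \<epsilon> ^ 5\<close>, three powers of
  \<open>\<epsilon>\<close> pay for comparing the end of a walk with the uniform distribution; the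
  remaining \<open>\<epsilon> ^ 2\<close> is of lower order than the main term
  \<open>\<epsilon>\<close>.\<close>

locale walk_count = mixing_relation +
  fixes K :: nat and \<epsilon> \<delta> :: real
  assumes K_pos: "K > 0" and rho: "\<rho> = \<epsilon> ^ 5" and eps_pos: "\<epsilon> > 0" and eps_le: "\<epsilon> \<le> \<delta>\<^sup>2 / 100"
    and del_pos: "\<delta> > 0" and del_le: "\<delta> \<le> 1/2"
    and tau_le: "(1 + \<delta>) * (d / card V) \<le> 1"
    and K_le: "(1 - (1 + \<delta>) * (d / card V)) ^ (2 * K) \<ge> \<epsilon>"
begin

section \<open>Walks in blocks and the sizes of free sets\<close>

definition \<tau> :: real where "\<tau> = (1 + \<delta>) * (d / n)"

lemma tau_bounds: "\<tau> > 0" "\<tau> \<le> 1" "(1 - \<tau>) ^ (2 * K) \<ge> \<epsilon>"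
  using tau_le K_le d_pos n_pos del_pos unfolding \<tau>_def n_def by auto

text \<open>In the first block truncated subtraction gives 0, so the window then reaches back to the
  first vertex.\<close>

definition window_start :: "nat \<Rightarrow> nat" where "window_start k = K * (k div K) - K"

text \<open>Walks are cut into blocks of \<open>K\<close> vertices. A new vertex avoids the neighbourhoods since the start
  of the preceding block, hence at least the last \<open>K\<close> vertices, while only the at most two block
  starts in \<open>windows k\<close> have to be kept under control.\<close>

definition windows :: "nat \<Rightarrow> nat set" where "windows k = {b. K dvd b \<and> b \<le> k \<and> k < b + 2 * K}"

lemma window_start_in: "window_start k \<in> windows k"
proof -
  have k: "k = K * (k div K) + k mod K" "k mod K < K" using K_pos by simp_all
  show ?thesis
  proof (cases "k div K")
    case 0
    then show ?thesis using k unfolding windows_def window_start_def by simp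
  next
    case (Suc m)
    then have "K * (k div K) - K = K * m" by simp
    then show ?thesis using k Suc unfolding windows_def window_start_def by simp
  qed
qed

lemma window_start_le: "window_start k \<le> k - K"
  unfolding window_start_def by (intro diff_le_mono) (simp add: mult.commute div_times_less_eq_dividend)

lemma windows_sub: "windows k \<subseteq> {K * (k div K), window_start k}"
proof
  fix b assume "b \<in> windows k"
  then obtain m where m: "b = K * m" "K * m \<le> k" "k < K * (m + 2)"
    unfolding windows_def by (auto simp: algebra_simps)
  then have "m \<le> k div K" "k div K < m + 2"
    using K_pos by (auto simp: less_eq_div_iff_mult_less_eq div_less_iff_less_mult mult.commute)
  then have "k div K = m \<or> k div K = m + 1" by auto
  then show "b \<in> {K * (k div K), window_start k}" using m unfolding window_start_def by auto
qed

lemma finite_windows: "finite (windows k)" and card_windows: "card (windows k) \<le> 2"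
proof -
  show "finite (windows k)" using windows_sub finite_subset by blast
  have "card (windows k) \<le> card {K * (k div K), window_start k}"
    using windows_sub by (intro card_mono) auto
  also have "\<dots> \<le> 2" by (simp add: card_insert_if)
  finally show "card (windows k) \<le> 2" .
qed

text \<open>For \<open>b \<ge> length P\<close> this is all of V: a window that has not begun
  forbids nothing.\<close>

definition free :: "'a list \<Rightarrow> nat \<Rightarrow> 'a set" where
  "free P b = {x \<in> V. \<forall>j. b \<le> j \<and> j < length P \<longrightarrow> \<not> C (P ! j) x}"

definition typical :: "'a list \<Rightarrow> nat \<Rightarrow> 'a \<Rightarrow> bool" where
  "typical P b w \<longleftrightarrow> real (card {y \<in> free P b. C w y}) \<le> \<tau> * card (free P b)"

text \<open>As \<open>C\<close> is meant to be reflexive, avoiding \<open>C (P ! j)\<close> for all but the last vertex also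
  rules out staying at the last vertex, which is adjacent to the one before it.\<close>

definition ok :: "'a list \<Rightarrow> 'a \<Rightarrow> bool" where
  "ok P w \<longleftrightarrow> w \<in> free (butlast P) (window_start (length P)) \<and> (P \<noteq> [] \<longrightarrow> C (last P) w)
     \<and> (\<forall>b \<in> windows (length P). typical P b w)"

definition good :: "'a list \<Rightarrow> bool" where
  "good P \<longleftrightarrow> (\<forall>i < length P. ok (take i P) (P ! i))"

definition walks :: "nat \<Rightarrow> 'a list set" where
  "walks k = {P. good P \<and> length P = k}"

lemma good_Nil [simp]: "good []" unfolding good_def by simp

lemma good_snoc: "good (P @ [w]) \<longleftrightarrow> good P \<and> ok P w"
  unfolding good_def by (auto simp: nth_append less_Suc_eq)

lemma good_take: "good P \<Longrightarrow> good (take j P)"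
  unfolding good_def by (auto simp: min_def)

lemma free_sub: "free P b \<subseteq> V" unfolding free_def by auto

lemma finite_free [simp]: "finite (free P b)" using finite_subset[OF free_sub finV] .

lemma ok_in_V: "ok P w \<Longrightarrow> w \<in> V" unfolding ok_def using free_sub by auto

lemma good_set: "good P \<Longrightarrow> set P \<subseteq> V"
  by (induction P rule: rev_induct) (auto simp: good_snoc dest: ok_in_V)

lemma finite_walks: "finite (walks k)"
  by (rule finite_subset[OF _ finite_lists_length_eq[OF finV, of k]]) (auto simp: walks_def dest: good_set)

lemma walks_0: "walks 0 = {[]}" unfolding walks_def by auto

lemma walks_take: "P \<in> walks k \<Longrightarrow> j \<le> k \<Longrightarrow> take j P \<in> walks j"
  unfolding walks_def by (auto intro: good_take)

lemma walks_last: "P \<in> walks k \<Longrightarrow> k > 0 \<Longrightarrow> last P \<in> V"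
  unfolding walks_def using good_set last_in_set by fastforce

lemma sum_walks_Suc:
  fixes h :: "'a list \<Rightarrow> real"
  shows "(\<Sum>P\<in>walks (Suc k). h P) = (\<Sum>P\<in>walks k. \<Sum>w\<in>V. of_bool (ok P w) * h (P @ [w]))"
proof -
  have "(\<Sum>P\<in>walks k. \<Sum>w\<in>V. of_bool (ok P w) * h (P @ [w]))
     = (\<Sum>P\<in>walks k. \<Sum>w\<in>{w \<in> V. ok P w}. h (P @ [w]))"
    using finV by (intro sum.cong refl sum.mono_neutral_cong_right) auto
  also have "\<dots> = (\<Sum>(P,w)\<in>(SIGMA P:walks k. {w \<in> V. ok P w}). h (P @ [w]))"
    using finite_walks finV by (subst sum.Sigma) auto
  also have "\<dots> = (\<Sum>P\<in>walks (Suc k). h P)"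
  proof -
    have bij: "bij_betw (\<lambda>(P,w). P @ [w]) (SIGMA P:walks k. {w \<in> V. ok P w}) (walks (Suc k))"
      unfolding bij_betw_def
    proof
      show "inj_on (\<lambda>(P,w). P @ [w]) (SIGMA P:walks k. {w \<in> V. ok P w})" by (auto simp: inj_on_def)
      show "(\<lambda>(P,w). P @ [w]) ` (SIGMA P:walks k. {w \<in> V. ok P w}) = walks (Suc k)"
      proof (intro equalityI subsetI)
        fix P assume P: "P \<in> walks (Suc k)"
        then obtain Q w where Q: "P = Q @ [w]" unfolding walks_def by (cases P rule: rev_cases) auto
        then have "(Q, w) \<in> (SIGMA P:walks k. {w \<in> V. ok P w})"
          using P ok_in_V unfolding walks_def by (auto simp: good_snoc)
        then show "P \<in> (\<lambda>(P,w). P @ [w]) ` (SIGMA P:walks k. {w \<in> V. ok P w})"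
          using Q by (auto intro!: image_eqI[where x = "(Q,w)"])
      qed (auto simp: walks_def good_snoc)
    qed
    show ?thesis using sum.reindex_bij_betw[OF bij, of h] by (simp add: case_prod_unfold)
  qed
  finally show ?thesis ..
qed

text \<open>A new vertex at a position from \<open>b\<close> on removes its
  \<open>C\<close>-neighbours from the free set, at most a proportion \<open>\<tau>\<close> by
  typicality. Typicality for \<open>b\<close> was required of it because \<open>b\<close> stays
  among the windows for positions below \<open>b + 2 * K\<close>.\<close>

lemma free_step:
  assumes "good P" "K dvd b" "length P \<le> b + 2 * K" "j \<le> length P"
  shows "real (card (free P b)) \<ge> (1 - \<tau>) ^ (length P - j) * card (free (take j P) b)"
  using assms
proof (induction P rule: rev_induct)
  case (snoc w P)
  show ?case
  proof (cases "j = length (P @ [w])")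
    case False
    then have j: "j \<le> length P" using snoc.prems by simp
    have tk: "take j (P @ [w]) = take j P" using j by simp
    have gP: "good P" "ok P w" using snoc.prems by (auto simp: good_snoc)
    have IH: "(1 - \<tau>) ^ (length P - j) * card (free (take j P) b) \<le> card (free P b)"
      using snoc.IH[OF gP(1) snoc.prems(2) _ j] snoc.prems by simp
    have "real (card (free (P @ [w]) b)) \<ge> (1 - \<tau>) * card (free P b)"
    proof (cases "b \<le> length P")
      case True
      then have b: "b \<in> windows (length P)" using snoc.prems unfolding windows_def by auto
      have "free (P @ [w]) b = free P b - {y \<in> free P b. C w y}"
        using True unfolding free_def by (auto simp: nth_append less_Suc_eq)
      then have "real (card (free (P @ [w]) b)) = card (free P b) - card {y \<in> free P b. C w y}"
        by (simp add: card_Diff_subset card_mono of_nat_diff)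
      moreover have "typical P b w" using gP(2) b unfolding ok_def by blast
      ultimately show ?thesis unfolding typical_def by (simp add: algebra_simps)
    next
      case False
      then have "free (P @ [w]) b = V" "free P b = V" unfolding free_def by auto
      then show ?thesis using tau_bounds by (simp add: mult_left_le_one_le)
    qed
    moreover have "(1 - \<tau>) * ((1 - \<tau>) ^ (length P - j) * card (free (take j P) b)) \<le> (1 - \<tau>) * card (free P b)"
      using IH tau_bounds by (intro mult_left_mono) auto
    ultimately show ?thesis using j by (simp add: tk Suc_diff_le)
  qed simp
qed simp

lemma card_free:
  assumes "good P" "K dvd b" "length P \<le> b + 2 * K"
  shows "real (card (free P b)) \<ge> \<epsilon> * n"
proof -
  have e1: "\<epsilon> \<le> (1 - \<tau>) ^ m" if "m \<le> 2 * K" for m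
    using tau_bounds that power_decreasing[of m "2 * K" "1 - \<tau>"] by auto
  show ?thesis
  proof (cases "b \<le> length P")
    case True
    have "free (take b P) b = V" unfolding free_def by auto
    then have "(1 - \<tau>) ^ (length P - b) * n \<le> card (free P b)"
      using free_step[OF assms True] unfolding n_def by simp
    moreover have "\<epsilon> * n \<le> (1 - \<tau>) ^ (length P - b) * n"
      using assms n_pos by (intro mult_right_mono e1) auto
    ultimately show ?thesis by linarith
  next
    case False
    then have "free P b = V" unfolding free_def by auto
    then show ?thesis using e1[of 0] n_pos unfolding n_def by (simp add: mult_left_le_one_le)
  qed
qed

section \<open>Distribution of the end of a walk, given a prefix\<close>

text \<open>Below, only sums of these weights over all prefixes \<open>Q\<close> are bounded from below: a single prefix may
  have no continuation.\<close>

definition endpoint_weight :: "nat \<Rightarrow> nat \<Rightarrow> 'a list \<Rightarrow> 'a \<Rightarrow> real" where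
  "endpoint_weight j k Q x = (\<Sum>P\<in>walks k. of_bool (take j P = Q \<and> last P = x))"

text \<open>If, for every prefix, the end were uniformly distributed on V, the value would be
  \<open>num_walks k / sqrt n\<close>; this is the benchmark for all bounds below.\<close>

definition endpoint_norm :: "nat \<Rightarrow> nat \<Rightarrow> real" where "endpoint_norm j k = (\<Sum>Q\<in>walks j. L2_set (endpoint_weight j k Q) V)"

definition num_walks :: "nat \<Rightarrow> real" where "num_walks k = real (card (walks k))"

lemma endpoint_weight_nonneg: "endpoint_weight j k Q x \<ge> 0" unfolding endpoint_weight_def by (intro sum_nonneg) auto

lemma sum_fibre:
  fixes h :: "'a list \<Rightarrow> 'a \<Rightarrow> real"
  assumes "j \<le> k" "k > 0"
  shows "(\<Sum>Q\<in>walks j. \<Sum>x\<in>V. endpoint_weight j k Q x * h Q x) = (\<Sum>P\<in>walks k. h (take j P) (last P))"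
proof -
  have "(\<Sum>Q\<in>walks j. \<Sum>x\<in>V. endpoint_weight j k Q x * h Q x)
    = (\<Sum>Q\<in>walks j. \<Sum>x\<in>V. \<Sum>P\<in>walks k. of_bool (take j P = Q \<and> last P = x) * h Q x)"
    unfolding endpoint_weight_def sum_distrib_right ..
  also have "\<dots> = (\<Sum>Q\<in>walks j. \<Sum>P\<in>walks k. \<Sum>x\<in>V. of_bool (take j P = Q \<and> last P = x) * h Q x)"
    by (intro sum.cong refl sum.swap)
  also have "\<dots> = (\<Sum>P\<in>walks k. \<Sum>Q\<in>walks j. \<Sum>x\<in>V. of_bool (take j P = Q \<and> last P = x) * h Q x)"
    by (rule sum.swap)
  also have "\<dots> = (\<Sum>P\<in>walks k. h (take j P) (last P))"
  proof (intro sum.cong refl)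
    fix P assume P: "P \<in> walks k"
    have "(\<Sum>Q\<in>walks j. \<Sum>x\<in>V. of_bool (take j P = Q \<and> last P = x) * h Q x)
       = (\<Sum>Q\<in>walks j. \<Sum>x\<in>V. if x = last P then of_bool (take j P = Q) * h Q x else 0)"
      by (intro sum.cong refl) auto
    also have "\<dots> = (\<Sum>Q\<in>walks j. if Q = take j P then h Q (last P) else 0)"
      using finV walks_last[OF P assms(2)] by (intro sum.cong refl) auto
    also have "\<dots> = h (take j P) (last P)"
      using walks_take[OF P assms(1)] finite_walks by simp
    finally show "(\<Sum>Q\<in>walks j. \<Sum>x\<in>V. of_bool (take j P = Q \<and> last P = x) * h Q x) = h (take j P) (last P)" .
  qed
  finally show ?thesis .
qed

lemma sum_endpoint_weight: "j \<le> k \<Longrightarrow> k > 0 \<Longrightarrow> (\<Sum>Q\<in>walks j. \<Sum>x\<in>V. endpoint_weight j k Q x) = num_walks k"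
  using sum_fibre[of j k "\<lambda>_ _. 1"] unfolding num_walks_def by simp

text \<open>The target set may depend on the walk only through its prefix. Mixing is then applied
  for each prefix to its endpoint weights, and the errors add up to
  \<open>endpoint_norm\<close>.\<close>

lemma mixing_walks:
  assumes jk: "j \<le> k" "k > 0" and Y: "\<And>Q. Q \<in> walks j \<Longrightarrow> Y Q \<subseteq> V"
    and y: "\<And>Q. Q \<in> walks j \<Longrightarrow> real (card (Y Q)) \<le> y"
  shows "\<bar>(\<Sum>P\<in>walks k. real (card {w \<in> Y (take j P). C (last P) w})) - d / n * (\<Sum>P\<in>walks k. real (card (Y (take j P))))\<bar>
     \<le> \<rho> * d * (sqrt y * endpoint_norm j k)"
proof -
  have "\<bar>(\<Sum>Q\<in>walks j. (\<Sum>x\<in>V. endpoint_weight j k Q x * real (card {w \<in> Y Q. C x w})) - d / n * (\<Sum>x\<in>V. endpoint_weight j k Q x * real (card (Y Q))))\<bar>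
     \<le> (\<Sum>Q\<in>walks j. \<rho> * d * (sqrt y * L2_set (endpoint_weight j k Q) V))"
  proof (intro order_trans[OF sum_abs] sum_mono)
    fix Q assume Q: "Q \<in> walks j"
    have "\<bar>(\<Sum>x\<in>V. endpoint_weight j k Q x * real (card {w \<in> Y Q. C x w})) - d / n * (\<Sum>x\<in>V. endpoint_weight j k Q x * real (card (Y Q)))\<bar>
      \<le> \<rho> * d * (L2_set (endpoint_weight j k Q) V * sqrt (card (Y Q)))"
      using mixing_set[OF Y[OF Q], of "endpoint_weight j k Q"] endpoint_weight_nonneg by (simp add: sum_distrib_right mult.assoc)
    also have "\<dots> \<le> \<rho> * d * (L2_set (endpoint_weight j k Q) V * sqrt y)"
      using rho_nonneg d_pos y[OF Q] by (intro mult_left_mono) auto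
    finally show "\<bar>(\<Sum>x\<in>V. endpoint_weight j k Q x * real (card {w \<in> Y Q. C x w})) - d / n * (\<Sum>x\<in>V. endpoint_weight j k Q x * real (card (Y Q)))\<bar>
      \<le> \<rho> * d * (sqrt y * L2_set (endpoint_weight j k Q) V)" by (simp add: mult_ac)
  qed
  then show ?thesis
    using sum_fibre[OF jk, of "\<lambda>Q x. real (card {w \<in> Y Q. C x w})"] sum_fibre[OF jk, of "\<lambda>Q x. real (card (Y Q))"]
    by (simp only: sum_subtractf sum_distrib_left[symmetric] endpoint_norm_def)
qed

text \<open>Of the conditions on a new vertex only its relation to the last vertex is kept. This
  dominates the new weights by the old ones pushed forward along \<open>C\<close>, to which
  \<open>L2_step\<close> applies.\<close>

lemma endpoint_norm_step:
  assumes jk: "j \<le> k" "k > 0"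
  shows "endpoint_norm j (Suc k) \<le> d / sqrt n * num_walks k + \<rho> * d * endpoint_norm j k"
proof -
  have "L2_set (endpoint_weight j (Suc k) Q) V \<le> d / sqrt n * (\<Sum>x\<in>V. endpoint_weight j k Q x) + \<rho> * d * L2_set (endpoint_weight j k Q) V" for Q
  proof -
    have "endpoint_weight j (Suc k) Q y \<le> (\<Sum>x\<in>V. endpoint_weight j k Q x * of_bool (C x y))" if y: "y \<in> V" for y
    proof -
      have "endpoint_weight j (Suc k) Q y = (\<Sum>P\<in>walks k. \<Sum>w\<in>V. of_bool (ok P w) * of_bool (take j P = Q \<and> w = y))"
        unfolding endpoint_weight_def sum_walks_Suc using jk by (intro sum.cong refl) (auto simp: walks_def)
      also have "\<dots> = (\<Sum>P\<in>walks k. \<Sum>w\<in>V. if w = y then of_bool (ok P y \<and> take j P = Q) else 0)"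
        by (intro sum.cong refl) auto
      also have "\<dots> = (\<Sum>P\<in>walks k. of_bool (ok P y \<and> take j P = Q))"
        using y finV by simp
      also have "\<dots> \<le> (\<Sum>P\<in>walks k. of_bool (take j P = Q) * of_bool (C (last P) y))"
        using jk by (intro sum_mono) (auto simp: ok_def walks_def)
      also have "\<dots> = (\<Sum>P\<in>walks k. \<Sum>x\<in>V. if x = last P then of_bool (take j P = Q \<and> last P = x) * of_bool (C x y) else 0)"
        using finV walks_last jk by (intro sum.cong refl) auto
      also have "\<dots> = (\<Sum>P\<in>walks k. \<Sum>x\<in>V. of_bool (take j P = Q \<and> last P = x) * of_bool (C x y))"
        by (intro sum.cong refl) auto
      also have "\<dots> = (\<Sum>x\<in>V. endpoint_weight j k Q x * of_bool (C x y))"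
        unfolding endpoint_weight_def sum_distrib_right by (rule sum.swap)
      finally show ?thesis .
    qed
    then have "L2_set (endpoint_weight j (Suc k) Q) V \<le> L2_set (\<lambda>y. \<Sum>x\<in>V. endpoint_weight j k Q x * of_bool (C x y)) V"
      by (intro L2_set_mono) (auto intro: endpoint_weight_nonneg)
    also have "\<dots> \<le> d / sqrt n * (\<Sum>x\<in>V. endpoint_weight j k Q x) + \<rho> * d * L2_set (endpoint_weight j k Q) V"
      by (intro L2_step) (rule endpoint_weight_nonneg)
    finally show ?thesis .
  qed
  then have "endpoint_norm j (Suc k) \<le> (\<Sum>Q\<in>walks j. d / sqrt n * (\<Sum>x\<in>V. endpoint_weight j k Q x) + \<rho> * d * L2_set (endpoint_weight j k Q) V)"
    unfolding endpoint_norm_def by (intro sum_mono) auto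
  also have "\<dots> = d / sqrt n * num_walks k + \<rho> * d * endpoint_norm j k"
    unfolding sum_endpoint_weight[OF jk, symmetric] endpoint_norm_def by (simp add: sum.distrib sum_distrib_left)
  finally show ?thesis .
qed

text \<open>One step after the prefix the weights are 0 or 1 and live on the neighbours of its last
  vertex, the concentrated distribution from which the decay starts. The empty prefix has no last
  vertex and is treated in \<open>endpoint_norm_base_0\<close>.\<close>

lemma endpoint_norm_base:
  assumes j: "j > 0"
  shows "endpoint_norm j (Suc j) \<le> num_walks j * sqrt (3 * d)"
proof -
  have "L2_set (endpoint_weight j (Suc j) Q) V \<le> sqrt (3 * d)" if Q: "Q \<in> walks j" for Q
  proof -
    let ?N = "{y \<in> V. C (last Q) y}"
    have "endpoint_weight j (Suc j) Q y \<le> of_bool (y \<in> ?N)" if y: "y \<in> V" for y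
    proof -
      have "endpoint_weight j (Suc j) Q y = (\<Sum>P\<in>walks j. \<Sum>w\<in>V. if w = y then of_bool (ok P y \<and> P = Q) else 0)"
        unfolding endpoint_weight_def sum_walks_Suc by (intro sum.cong refl) (auto simp: walks_def)
      also have "\<dots> = (\<Sum>P\<in>walks j. if P = Q then of_bool (ok P y) else 0)"
        using y finV by (intro sum.cong refl) auto
      also have "\<dots> = of_bool (ok Q y)" using Q finite_walks by simp
      also have "\<dots> \<le> of_bool (y \<in> ?N)" using Q j y by (auto simp: ok_def walks_def)
      finally show ?thesis .
    qed
    then have "L2_set (endpoint_weight j (Suc j) Q) V \<le> L2_set (\<lambda>y. of_bool (y \<in> ?N)) V"
      by (intro L2_set_mono) (auto intro: endpoint_weight_nonneg)
    also have "\<dots> = sqrt (card ?N)" by (rule L2_of_bool) auto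
    also have "\<dots> \<le> sqrt (3 * d)" using deg[OF walks_last[OF Q j]] by simp
    finally show ?thesis .
  qed
  then have "endpoint_norm j (Suc j) \<le> (\<Sum>Q\<in>walks j. sqrt (3 * d))" unfolding endpoint_norm_def by (intro sum_mono)
  then show ?thesis by (simp add: num_walks_def)
qed

lemma endpoint_norm_base_0: "endpoint_norm 0 1 = sqrt (num_walks 1)"
proof -
  let ?A = "{x \<in> V. ok [] x}"
  have "endpoint_weight 0 1 [] y = of_bool (y \<in> ?A)" if y: "y \<in> V" for y
    using y finV sum_walks_Suc[of "\<lambda>P. of_bool (last P = y)" 0]
    by (simp add: endpoint_weight_def walks_0 of_bool_def if_distrib[of "\<lambda>x. _ * x"] cong: if_cong)
  then have "endpoint_norm 0 1 = L2_set (\<lambda>y. of_bool (y \<in> ?A)) V"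
    unfolding endpoint_norm_def walks_0 by (auto intro!: L2_set_cong)
  also have "\<dots> = sqrt (card ?A)" by (rule L2_of_bool) auto
  also have "real (card ?A) = num_walks 1"
    using sum_walks_Suc[of "\<lambda>_. 1" 0] by (simp add: num_walks_def walks_0 card_eq_sum)
  finally show ?thesis .
qed

section \<open>Decay of the endpoint norm under growth\<close>

lemma eps_small: "\<epsilon> \<le> 1/400" "\<epsilon> / \<delta>\<^sup>2 \<le> 1/100"
proof -
  have "\<delta>\<^sup>2 \<le> (1/2)\<^sup>2" using del_pos del_le by (intro power_mono) auto
  then show "\<epsilon> \<le> 1/400" using eps_le by (simp add: power2_eq_square)
  show "\<epsilon> / \<delta>\<^sup>2 \<le> 1/100" using eps_le del_pos by (simp add: field_simps)
qed

lemma eps_power_le: "\<epsilon> ^ m \<le> \<epsilon> ^ l" if "l \<le> m" for l m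
  using eps_pos eps_small that by (intro power_decreasing) auto

text \<open>This is \<open>2 * \<rho> / \<epsilon>\<close>, the error norm \<open>\<rho> * d\<close>
  of one step divided by the growth factor \<open>\<epsilon> / 2 * d\<close>.\<close>

definition q :: real where "q = 2 * \<epsilon> ^ 4"

lemma q_bounds: "0 < q" "q \<le> 1/2"
proof -
  show "0 < q" using eps_pos unfolding q_def by simp
  have "\<epsilon> ^ 4 \<le> \<epsilon> ^ 1" by (rule eps_power_le) simp
  then show "q \<le> 1/2" using eps_small unfolding q_def by simp
qed

text \<open>The uniform distribution on d vertices has an L2 norm larger by this factor than the one
  on all n vertices: the concentration to be undone after a prefix is fixed.\<close>

definition X :: real where "X = sqrt n / sqrt d"

lemma X_bounds: "X \<ge> 1" "X\<^sup>2 = n / d"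
proof -
  have "1 * (d / n) \<le> (1 + \<delta>) * (d / n)" using del_pos d_pos n_pos by (intro mult_right_mono) auto
  then have "d / n \<le> 1" using tau_bounds by (simp add: \<tau>_def)
  then have "d \<le> n" using n_pos by simp
  then show "X \<ge> 1" using d_pos by (simp add: X_def)
  show "X\<^sup>2 = n / d" using d_pos n_pos by (simp add: X_def power_divide)
qed

lemma num_walks_nonneg: "num_walks k \<ge> 0" unfolding num_walks_def by simp

text \<open>Covers only the steps before length k, so that norm bounds at length k can be used to
  prove the next growth step.\<close>

definition growing :: "nat \<Rightarrow> bool" where
  "growing k \<longleftrightarrow> num_walks 1 \<ge> n / 2 \<and> (\<forall>i. 0 < i \<and> i < k \<longrightarrow> num_walks (Suc i) \<ge> \<epsilon> / 2 * d * num_walks i)"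

text \<open>Relative to the number of walks, \<open>endpoint_norm_step\<close> becomes an affine
  recursion with contraction factor \<open>q\<close>. It turns
  \<open>4 / (\<epsilon> * sqrt n)\<close> into \<open>(2 + 4 * q) / (\<epsilon> * sqrt n)\<close>,
  which is no larger as \<open>q \<le> 1/2\<close>, while the excess \<open>c\<close> shrinks by
  \<open>q\<close>.\<close>

lemma endpoint_norm_recursion:
  assumes gr: "num_walks (Suc k) \<ge> \<epsilon> / 2 * d * num_walks k" and jk: "j \<le> k" "k > 0"
    and IH: "endpoint_norm j k \<le> num_walks k * (4 / (\<epsilon> * sqrt n) + c)" and c: "c \<ge> 0"
  shows "endpoint_norm j (Suc k) \<le> num_walks (Suc k) * (4 / (\<epsilon> * sqrt n) + q * c)"
proof -
  have ak: "num_walks k * d \<le> num_walks (Suc k) * (2 / \<epsilon>)" using gr eps_pos by (simp add: field_simps)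
  have "endpoint_norm j (Suc k) \<le> d / sqrt n * num_walks k + \<rho> * d * endpoint_norm j k" by (rule endpoint_norm_step[OF jk])
  also have "\<dots> \<le> d / sqrt n * num_walks k + \<rho> * d * (num_walks k * (4 / (\<epsilon> * sqrt n) + c))"
    using IH rho_nonneg d_pos by (intro add_left_mono mult_left_mono) auto
  also have "\<dots> = (num_walks k * d) * (1 / sqrt n + \<rho> * (4 / (\<epsilon> * sqrt n) + c))" by (simp add: algebra_simps)
  also have "\<dots> \<le> (num_walks (Suc k) * (2 / \<epsilon>)) * (1 / sqrt n + \<rho> * (4 / (\<epsilon> * sqrt n) + c))"
    using n_pos rho_nonneg eps_pos c by (intro mult_right_mono[OF ak]) auto
  also have "\<dots> = num_walks (Suc k) * ((2 + 4 * q) / (\<epsilon> * sqrt n) + q * c)"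
    using n_pos eps_pos unfolding rho q_def by (simp add: field_simps eval_nat_numeral)
  also have "\<dots> \<le> num_walks (Suc k) * (4 / (\<epsilon> * sqrt n) + q * c)"
    using q_bounds eps_pos n_pos num_walks_nonneg by (intro mult_left_mono add_right_mono divide_right_mono) auto
  finally show ?thesis .
qed

lemma endpoint_norm_bound:
  assumes "growing k" "0 < j" "j < k"
  shows "endpoint_norm j k \<le> num_walks k * (4 / (\<epsilon> * sqrt n) + 4 * q ^ (k - j - 1) / (\<epsilon> * sqrt d))"
  using assms(3,1)
proof (induction k)
  case (Suc k)
  show ?case
  proof (cases "j = k")
    case True
    have gr: "num_walks (Suc j) \<ge> \<epsilon> / 2 * d * num_walks j" using Suc.prems assms(2) unfolding growing_def by simp
    then have aj: "num_walks j * d \<le> num_walks (Suc j) * (2 / \<epsilon>)" using eps_pos by (simp add: field_simps)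
    \<comment> \<open>The initial excess \<open>4 / (\<epsilon> * sqrt d)\<close> combines this 2
      with the factor \<open>2 / \<epsilon>\<close> from one step of growth.\<close>
    have s3: "sqrt 3 \<le> 2" by (rule real_le_lsqrt) auto
    have "endpoint_norm j (Suc j) \<le> num_walks j * sqrt (3 * d)" by (rule endpoint_norm_base[OF assms(2)])
    also have "\<dots> = (num_walks j * d) * (sqrt 3 / sqrt d)"
      using d_pos by (simp add: real_sqrt_mult field_simps)
    also have "\<dots> \<le> (num_walks (Suc j) * (2 / \<epsilon>)) * (2 / sqrt d)"
      using s3 d_pos eps_pos num_walks_nonneg by (intro mult_mono[OF aj] divide_right_mono mult_nonneg_nonneg) auto
    also have "\<dots> = num_walks (Suc j) * (0 + 4 * q ^ (Suc j - j - 1) / (\<epsilon> * sqrt d))" by simp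
    also have "\<dots> \<le> num_walks (Suc j) * (4 / (\<epsilon> * sqrt n) + 4 * q ^ (Suc j - j - 1) / (\<epsilon> * sqrt d))"
      using eps_pos n_pos num_walks_nonneg by (intro mult_left_mono add_right_mono) auto
    finally show ?thesis using True by simp
  next
    case False
    then have jk: "j < k" using Suc.prems by simp
    have "growing k" using Suc.prems unfolding growing_def by simp
    then have IH: "endpoint_norm j k \<le> num_walks k * (4 / (\<epsilon> * sqrt n) + 4 * q ^ (k - j - 1) / (\<epsilon> * sqrt d))"
      using Suc.IH jk by simp
    have "num_walks (Suc k) \<ge> \<epsilon> / 2 * d * num_walks k" using Suc.prems jk unfolding growing_def by simp
    from endpoint_norm_recursion[OF this _ _ IH] have "endpoint_norm j (Suc k) \<le> num_walks (Suc k) * (4 / (\<epsilon> * sqrt n) + q * (4 * q ^ (k - j - 1) / (\<epsilon> * sqrt d)))"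
      using jk q_bounds eps_pos d_pos by simp
    also have "q * (4 * q ^ (k - j - 1) / (\<epsilon> * sqrt d)) = 4 * q ^ (Suc k - j - 1) / (\<epsilon> * sqrt d)"
    proof -
      have "Suc k - j - 1 = Suc (k - j - 1)" using jk by simp
      then show ?thesis by simp
    qed
    finally show ?thesis .
  qed
qed simp

text \<open>With the empty prefix the walk starts from at least n/2 vertices of weight one. This is
  spread out already, so there is no decaying excess term.\<close>

lemma endpoint_norm_bound_0:
  assumes "growing k" "0 < k"
  shows "endpoint_norm 0 k \<le> num_walks k * (4 / (\<epsilon> * sqrt n))"
  using assms
proof (induction k)
  case (Suc k)
  show ?case
  proof (cases "k = 0")
    case True
    have a1: "n / 2 \<le> num_walks 1" using Suc.prems unfolding growing_def by simp
    have "(\<epsilon> / 4)\<^sup>2 \<le> 1 / 2"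
    proof -
      have "(\<epsilon> / 4)\<^sup>2 \<le> (1/2)\<^sup>2" using eps_pos eps_small by (intro power_mono) auto
      then show ?thesis by (simp add: power2_eq_square)
    qed
    then have "(\<epsilon> / 4)\<^sup>2 * n \<le> num_walks 1" using a1 n_pos mult_right_mono[of "(\<epsilon> / 4)\<^sup>2" "1/2" n] by linarith
    then have "\<epsilon> / 4 * sqrt n \<le> sqrt (num_walks 1)"
      using n_pos eps_pos by (intro real_le_rsqrt) (simp add: power_mult_distrib power_divide)
    then have "sqrt (num_walks 1) * (\<epsilon> / 4 * sqrt n) \<le> sqrt (num_walks 1) * sqrt (num_walks 1)"
      using num_walks_nonneg by (intro mult_left_mono) auto
    also have "\<dots> = num_walks 1" using num_walks_nonneg by simp
    finally have "sqrt (num_walks 1) \<le> num_walks 1 * (4 / (\<epsilon> * sqrt n))" using eps_pos n_pos by (simp add: field_simps)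
    then show ?thesis using True endpoint_norm_base_0 by simp
  next
    case False
    have "growing k" using Suc.prems unfolding growing_def by simp
    then have IH: "endpoint_norm 0 k \<le> num_walks k * (4 / (\<epsilon> * sqrt n) + 0)" using Suc.IH False by simp
    have "num_walks (Suc k) \<ge> \<epsilon> / 2 * d * num_walks k" using Suc.prems False unfolding growing_def by simp
    from endpoint_norm_recursion[OF this _ _ IH] show ?thesis using False by simp
  qed
qed simp

text \<open>The scale \<open>m\<close> separates the recent vertices, whose chords are counted one by one, from the prefix,
  from which the end of the walk has decoupled.\<close>

lemma rho_endpoint_norm_le:
  assumes gr: "growing k" and k: "0 < k" and m: "0 < m" and Xq: "X * q ^ (m - 1) \<le> 1 / \<epsilon>\<^sup>2"
  shows "\<rho> * d * (sqrt n * endpoint_norm (k - m) k) \<le> d * num_walks k * (8 * \<epsilon>\<^sup>2)"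
proof -
  have e4: "\<epsilon> ^ 4 \<le> \<epsilon>\<^sup>2" by (rule eps_power_le) simp
  have "\<rho> * (sqrt n * endpoint_norm (k - m) k) \<le> num_walks k * (8 * \<epsilon>\<^sup>2)"
  proof (cases "k \<le> m")
    case True
    then have "sqrt n * endpoint_norm (k - m) k \<le> sqrt n * (num_walks k * (4 / (\<epsilon> * sqrt n)))"
      using endpoint_norm_bound_0[OF gr k] n_pos by (intro mult_left_mono) auto
    also have "\<dots> = num_walks k * (4 / \<epsilon>)" using n_pos by simp
    finally have "\<rho> * (sqrt n * endpoint_norm (k - m) k) \<le> \<rho> * (num_walks k * (4 / \<epsilon>))"
      using rho_nonneg by (rule mult_left_mono)
    also have "\<dots> = num_walks k * (4 * \<epsilon> ^ 4)" using eps_pos unfolding rho by (simp add: field_simps eval_nat_numeral)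
    also have "\<dots> \<le> num_walks k * (8 * \<epsilon>\<^sup>2)" using e4 num_walks_nonneg zero_le_power2[of \<epsilon>] by (intro mult_left_mono) linarith+
    finally show ?thesis .
  next
    case False
    then have "sqrt n * endpoint_norm (k - m) k \<le> sqrt n * (num_walks k * (4 / (\<epsilon> * sqrt n) + 4 * q ^ (k - (k - m) - 1) / (\<epsilon> * sqrt d)))"
      using endpoint_norm_bound[OF gr, of "k - m"] n_pos m by (intro mult_left_mono) auto
    also have "k - (k - m) - 1 = m - 1" using False by simp
    also have "sqrt n * (num_walks k * (4 / (\<epsilon> * sqrt n) + 4 * q ^ (m - 1) / (\<epsilon> * sqrt d))) = num_walks k * (4 / \<epsilon> * (1 + X * q ^ (m - 1)))"
      using n_pos d_pos eps_pos by (simp add: X_def field_simps)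
    also have "\<dots> \<le> num_walks k * (4 / \<epsilon> * (1 + 1 / \<epsilon>\<^sup>2))"
      using Xq num_walks_nonneg eps_pos by (intro mult_left_mono add_left_mono) auto
    finally have "\<rho> * (sqrt n * endpoint_norm (k - m) k) \<le> \<rho> * (num_walks k * (4 / \<epsilon> * (1 + 1 / \<epsilon>\<^sup>2)))"
      using rho_nonneg by (rule mult_left_mono)
    also have "\<dots> = num_walks k * (4 * \<epsilon> ^ 4 + 4 * \<epsilon>\<^sup>2)" using eps_pos unfolding rho by (simp add: field_simps eval_nat_numeral)
    also have "\<dots> \<le> num_walks k * (8 * \<epsilon>\<^sup>2)" using e4 num_walks_nonneg by (intro mult_left_mono) auto
    finally show ?thesis .
  qed
  then show ?thesis using d_pos mult_left_mono[of _ _ d] by (simp add: mult_ac)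
qed

section \<open>Losses from recent chords and from atypical extensions\<close>

lemma geometric_tail: "(\<Sum>i\<in>{j..<k - 1}. q ^ (k - 2 - i)) \<le> 2"
proof -
  have "(\<Sum>i\<in>{j..<k - 1}. q ^ (k - 2 - i)) \<le> (\<Sum>i<k - 1. q ^ (k - 1 - Suc i))"
  proof -
    have "(\<Sum>i\<in>{j..<k - 1}. q ^ (k - 2 - i)) = (\<Sum>i\<in>{j..<k - 1}. q ^ (k - 1 - Suc i))"
      by (intro sum.cong refl) (simp add: numeral_2_eq_2)
    also have "\<dots> \<le> (\<Sum>i<k - 1. q ^ (k - 1 - Suc i))" using q_bounds by (intro sum_mono2) auto
    finally show ?thesis .
  qed
  also have "\<dots> = (\<Sum>i<k - 1. q ^ i)" by (rule sum.nat_diff_reindex)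
  also have "\<dots> \<le> 1 / (1 - q)" using q_bounds by (auto simp: sum_gp_strict divide_right_mono)
  also have "\<dots> \<le> 2" using q_bounds by (simp add: field_simps)
  finally show ?thesis .
qed

text \<open>The neighbourhood of \<open>P ! i\<close> is determined by the prefix of length
  \<open>i + 1\<close>, so \<open>mixing_walks\<close> applies with target sets of size at most
  \<open>3 * d\<close>. Each index costs a proportion of order \<open>d / n = 1 / X ^ 2\<close> plus
  errors; at most 2X indices cost O(1/X) in the main term, small in the sparse case, and for m = 1
  the range is empty. Errors decaying with the distance to the end are summed geometrically.\<close>

lemma recent_chords:
  assumes gr: "growing k" and k: "0 < k" and m: "0 < m" "real (m - 1) \<le> 2 * X" "m = 1 \<or> X \<ge> 1 / \<epsilon>\<^sup>2"
  shows "(\<Sum>i\<in>{k - m..<k - 1}. \<Sum>P\<in>walks k. real (card {w \<in> V. C (P ! i) w \<and> C (last P) w}))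
     \<le> d * num_walks k * (38 * \<epsilon>\<^sup>2)"
proof -
  have e4: "\<epsilon> ^ 4 \<le> \<epsilon>\<^sup>2" by (rule eps_power_le) simp
  have one: "(\<Sum>P\<in>walks k. real (card {w \<in> V. C (P ! i) w \<and> C (last P) w}))
     \<le> d * num_walks k * (3 / X\<^sup>2 + 8 * \<epsilon> ^ 4 / X + 8 * \<epsilon> ^ 4 * q ^ (k - 2 - i))" if i: "i \<in> {k - m..<k - 1}" for i
  proof -
    have ik: "Suc i < k" using i by auto
    define Y where "Y Q = {w \<in> V. C (last Q) w}" for Q
    have lt: "last (take (Suc i) P) = P ! i" if "P \<in> walks k" for P
      using that ik by (auto simp: walks_def take_Suc_conv_app_nth)
    have Yc: "real (card (Y Q)) \<le> 3 * d" if "Q \<in> walks (Suc i)" for Q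
      unfolding Y_def using deg walks_last[OF that] by simp
    have "(\<Sum>P\<in>walks k. real (card {w \<in> V. C (P ! i) w \<and> C (last P) w}))
      = (\<Sum>P\<in>walks k. real (card {w \<in> Y (take (Suc i) P). C (last P) w}))"
      by (intro sum.cong refl) (simp add: Y_def lt)
    also have "\<dots> \<le> d / n * (\<Sum>P\<in>walks k. real (card (Y (take (Suc i) P)))) + \<rho> * d * (sqrt (3 * d) * endpoint_norm (Suc i) k)"
      using mixing_walks[of "Suc i" k Y "3 * d"] ik Yc unfolding Y_def by auto
    also have "(\<Sum>P\<in>walks k. real (card (Y (take (Suc i) P)))) \<le> num_walks k * (3 * d)"
      using sum_bounded_above[of "walks k" "\<lambda>P. real (card (Y (take (Suc i) P)))" "3 * d"]
        Yc walks_take[of _ k "Suc i"] ik unfolding num_walks_def by auto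
    finally have 1: "(\<Sum>P\<in>walks k. real (card {w \<in> V. C (P ! i) w \<and> C (last P) w}))
       \<le> d / n * (num_walks k * (3 * d)) + \<rho> * d * (sqrt (3 * d) * endpoint_norm (Suc i) k)"
      using d_pos n_pos by (simp add: mult_left_mono divide_right_mono)
    have s3: "sqrt (3 * d) \<le> 2 * sqrt d"
      using real_sqrt_le_mono[of "3 * d" "4 * d"] d_pos by (simp add: real_sqrt_mult)
    have "sqrt (3 * d) * endpoint_norm (Suc i) k \<le> (2 * sqrt d) * (num_walks k * (4 / (\<epsilon> * sqrt n) + 4 * q ^ (k - Suc i - 1) / (\<epsilon> * sqrt d)))"
      using endpoint_norm_bound[OF gr, of "Suc i"] ik s3 d_pos by (intro mult_mono) (auto simp: endpoint_norm_def sum_nonneg)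
    also have "\<dots> = num_walks k * (8 / \<epsilon> * (1 / X + q ^ (k - 2 - i)))"
    proof -
      have "k - Suc i - 1 = k - 2 - i" by simp
      then show ?thesis using d_pos n_pos eps_pos by (simp add: X_def field_simps)
    qed
    finally have "\<rho> * d * (sqrt (3 * d) * endpoint_norm (Suc i) k) \<le> \<rho> * d * (num_walks k * (8 / \<epsilon> * (1 / X + q ^ (k - 2 - i))))"
      using rho_nonneg d_pos by (intro mult_left_mono) auto
    also have "\<dots> = d * num_walks k * (8 * \<epsilon> ^ 4 / X + 8 * \<epsilon> ^ 4 * q ^ (k - 2 - i))"
      using eps_pos X_bounds unfolding rho by (simp add: field_simps eval_nat_numeral)
    finally have 2: "\<rho> * d * (sqrt (3 * d) * endpoint_norm (Suc i) k) \<le> d * num_walks k * (8 * \<epsilon> ^ 4 / X + 8 * \<epsilon> ^ 4 * q ^ (k - 2 - i))" .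
    have "d / n * (num_walks k * (3 * d)) = d * num_walks k * (3 / X\<^sup>2)"
      unfolding X_bounds(2) using d_pos n_pos by simp
    with 1 2 show ?thesis by (simp add: algebra_simps)
  qed
  have c: "real (card {k - m..<k - 1}) \<le> real (m - 1)" by simp
  have "(\<Sum>i\<in>{k - m..<k - 1}. 3 / X\<^sup>2 + 8 * \<epsilon> ^ 4 / X + 8 * \<epsilon> ^ 4 * q ^ (k - 2 - i))
    = real (card {k - m..<k - 1}) * (3 / X\<^sup>2 + 8 * \<epsilon> ^ 4 / X) + 8 * \<epsilon> ^ 4 * (\<Sum>i\<in>{k - m..<k - 1}. q ^ (k - 2 - i))"
    by (simp add: sum.distrib sum_distrib_left algebra_simps)
  also have "\<dots> \<le> real (m - 1) * (3 / X\<^sup>2 + 8 * \<epsilon> ^ 4 / X) + 8 * \<epsilon> ^ 4 * 2"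
    using c geometric_tail[where j = "k - m"] eps_pos X_bounds(1)
    by (intro add_mono mult_right_mono mult_left_mono add_nonneg_nonneg divide_nonneg_nonneg) auto
  also have "real (m - 1) * (3 / X\<^sup>2 + 8 * \<epsilon> ^ 4 / X) \<le> 6 * \<epsilon>\<^sup>2 + 16 * \<epsilon> ^ 4"
  proof (cases "m = 1")
    case False
    then have XX: "1 / X \<le> \<epsilon>\<^sup>2" using m X_bounds eps_pos by (simp add: field_simps)
    have "real (m - 1) * (3 / X\<^sup>2 + 8 * \<epsilon> ^ 4 / X) \<le> 2 * X * (3 / X\<^sup>2 + 8 * \<epsilon> ^ 4 / X)"
      using m X_bounds(1) eps_pos by (intro mult_right_mono add_nonneg_nonneg divide_nonneg_nonneg) auto
    also have "\<dots> = 6 * (1 / X) + 16 * \<epsilon> ^ 4" using X_bounds(1) by (simp add: field_simps power2_eq_square)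
    finally show ?thesis using XX by simp
  qed (use eps_pos in auto)
  \<comment> \<open>38 = 6 + 16 + 16, after bounding \<open>\<epsilon> ^ 4\<close> by
    \<open>\<epsilon> ^ 2\<close>.\<close>
  finally have "(\<Sum>i\<in>{k - m..<k - 1}. 3 / X\<^sup>2 + 8 * \<epsilon> ^ 4 / X + 8 * \<epsilon> ^ 4 * q ^ (k - 2 - i)) \<le> 38 * \<epsilon>\<^sup>2"
    using e4 by linarith
  then have "d * num_walks k * (\<Sum>i\<in>{k - m..<k - 1}. 3 / X\<^sup>2 + 8 * \<epsilon> ^ 4 / X + 8 * \<epsilon> ^ 4 * q ^ (k - 2 - i)) \<le> d * num_walks k * (38 * \<epsilon>\<^sup>2)"
    using d_pos num_walks_nonneg by (intro mult_left_mono) auto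
  then show ?thesis
    unfolding sum_distrib_left by (intro order_trans[OF sum_mono[OF one]])
qed

text \<open>\<open>\<rho> ^ 2\<close> divided by the density \<open>\<epsilon>\<close> of the free
  set is \<open>\<epsilon> ^ 9\<close>; one of these factors absorbs
  \<open>4 / \<delta> ^ 2\<close>. The range of \<open>\<theta>\<close> includes the threshold
  \<delta> used for walks and the threshold \<delta>/2 used for their prefixes.\<close>

lemma card_atypical_free:
  assumes "good Q" "K dvd b" "length Q \<le> b + 2 * K" and \<theta>: "\<theta> \<ge> \<delta> / 2"
  shows "real (card (atypical \<theta> (free Q b))) \<le> \<epsilon> ^ 8 * n"
proof -
  have cf: "\<epsilon> * n \<le> card (free Q b)" by (rule card_free[OF assms(1-3)])
  have en: "\<epsilon> * n > 0" using eps_pos n_pos by simp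
  have cp: "0 < card (free Q b)" using cf en of_nat_0_less_iff by fastforce
  have th: "(\<delta> / 2)\<^sup>2 \<le> \<theta>\<^sup>2" using \<theta> del_pos by (intro power_mono) auto
  have "real (card (atypical \<theta> (free Q b))) \<le> \<rho>\<^sup>2 * n\<^sup>2 / (\<theta>\<^sup>2 * card (free Q b))"
    using cp \<theta> del_pos by (intro card_atypical free_sub) auto
  also have "\<dots> \<le> \<rho>\<^sup>2 * n\<^sup>2 / ((\<delta> / 2)\<^sup>2 * (\<epsilon> * n))"
    using cf cp th del_pos eps_pos n_pos by (intro divide_left_mono mult_mono mult_pos_pos) auto
  also have "\<dots> = \<epsilon> ^ 8 * n * (4 * (\<epsilon> / \<delta>\<^sup>2))"
    using n_pos eps_pos del_pos unfolding rho by (simp add: field_simps eval_nat_numeral)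
  also have "\<dots> \<le> \<epsilon> ^ 8 * n * 1"
  proof (rule mult_left_mono)
    show "4 * (\<epsilon> / \<delta>\<^sup>2) \<le> 1" using eps_small(2) by linarith
  qed (use n_pos eps_pos in auto)
  finally show ?thesis by simp
qed

lemma not_typical_iff: "w \<in> V \<Longrightarrow> \<not> typical P b w \<longleftrightarrow> w \<in> atypical \<delta> (free P b)"
  unfolding typical_def atypical_def \<tau>_def by auto

lemma atypical_extensions_dense:
  assumes k: "0 < k" and b: "b \<in> windows k" and XX: "X \<le> 1 / \<epsilon>\<^sup>2"
  shows "(\<Sum>P\<in>walks k. real (card {w \<in> V. C (last P) w \<and> \<not> typical P b w})) \<le> d * num_walks k * \<epsilon>\<^sup>2"
proof -
  have "real (card {w \<in> V. C (last P) w \<and> \<not> typical P b w}) \<le> d * \<epsilon>\<^sup>2" if P: "P \<in> walks k" for P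
  proof -
    have "card {w \<in> V. C (last P) w \<and> \<not> typical P b w} \<le> card (atypical \<delta> (free P b))"
      using finV by (intro card_mono) (auto simp: not_typical_iff atypical_def[of \<delta>] intro: finite_subset[OF _ finV])
    also have "real \<dots> \<le> \<epsilon> ^ 8 * n"
      using P b del_pos by (intro card_atypical_free) (auto simp: walks_def windows_def)
    also have "\<dots> = d * (\<epsilon> ^ 8 * X\<^sup>2)" using d_pos unfolding X_def using n_pos by (simp add: power_divide)
    also have "\<dots> \<le> d * (\<epsilon> ^ 8 * (1 / \<epsilon>\<^sup>2)\<^sup>2)"
      using XX X_bounds(1) d_pos eps_pos by (intro mult_left_mono power_mono) auto
    also have "\<dots> = d * \<epsilon> ^ 4" using eps_pos by (simp add: field_simps eval_nat_numeral)
    also have "\<dots> \<le> d * \<epsilon>\<^sup>2" using d_pos by (intro mult_left_mono eps_power_le) auto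
    finally show ?thesis by simp
  qed
  then show ?thesis
    using sum_bounded_above[of "walks k" "\<lambda>P. real (card {w \<in> V. C (last P) w \<and> \<not> typical P b w})" "d * \<epsilon>\<^sup>2"]
    unfolding num_walks_def by (simp add: mult_ac)
qed

text \<open>The atypical set of the full walk depends on its last steps, so mixing does not apply to
  it. But the last m steps keep at least the proportion \<open>1 - 5 * \<epsilon> ^ 2\<close> of the
  free set, so a vertex atypical for the walk with threshold \<delta> is atypical for the prefix
  with threshold \<delta>/2, and the latter set is fixed by the prefix.\<close>

lemma atypical_extensions_sparse:
  assumes gr: "growing k" and k: "0 < k" and b: "b \<in> windows k" and m: "0 < m" "real (m - 1) \<le> 2 * X"
    and Xq: "X * q ^ (m - 1) \<le> 1 / \<epsilon>\<^sup>2" and XX: "X \<ge> 1 / \<epsilon>\<^sup>2"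
  shows "(\<Sum>P\<in>walks k. real (card {w \<in> V. C (last P) w \<and> \<not> typical P b w})) \<le> d * num_walks k * \<epsilon>\<^sup>2"
proof -
  define j where "j = k - m"
  have jk: "j \<le> k" unfolding j_def by simp
  have kb: "K dvd b" "k \<le> b + 2 * K" using b unfolding windows_def by auto
  define Y where "Y Q = atypical (\<delta> / 2) (free Q b)" for Q
  have YV: "Y Q \<subseteq> V" for Q unfolding Y_def atypical_def by auto
  have Yc: "real (card (Y Q)) \<le> \<epsilon> ^ 8 * n" if "Q \<in> walks j" for Q
    unfolding Y_def using that kb jk by (intro card_atypical_free) (auto simp: walks_def)
  have X1: "1 / X \<le> \<epsilon>\<^sup>2" using XX X_bounds(1) eps_pos by (simp add: field_simps)
  \<comment> \<open>From \<open>m \<le> 2 * X + 1 \<le> 3 * X\<close> and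
    \<open>1 + \<delta> \<le> 3/2\<close>.\<close>
  have "m * \<tau> \<le> (3 * X) * (3/2 * (d / n))"
    using m X_bounds(1) del_le d_pos n_pos del_pos unfolding \<tau>_def by (intro mult_mono mult_right_mono) auto
  also have "\<dots> = 9/2 * (1 / X)"
  proof -
    have dn: "d / n = 1 / X\<^sup>2" unfolding X_bounds(2) by simp
    show ?thesis unfolding dn using X_bounds(1) by (simp add: power2_eq_square)
  qed
  finally have mt: "m * \<tau> \<le> 5 * \<epsilon>\<^sup>2" using X1 zero_le_power2[of \<epsilon>] by linarith
  have ed: "\<epsilon> \<le> \<delta> / 200"
  proof -
    have "\<delta>\<^sup>2 \<le> \<delta> * (1/2)" unfolding power2_eq_square using del_pos del_le by (intro mult_left_mono) auto
    then show ?thesis using eps_le by simp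
  qed
  have "\<epsilon>\<^sup>2 \<le> \<epsilon> * 1" unfolding power2_eq_square using eps_pos eps_small by (intro mult_left_mono) auto
  then have e2: "15 * \<epsilon>\<^sup>2 \<le> \<delta>" using ed eps_pos by linarith
  have sub: "{w \<in> V. C (last P) w \<and> \<not> typical P b w} \<subseteq> {w \<in> Y (take j P). C (last P) w}" if P: "P \<in> walks k" for P
  proof
    fix w assume w: "w \<in> {w \<in> V. C (last P) w \<and> \<not> typical P b w}"
    have gP: "good P" "length P = k" using P unfolding walks_def by auto
    let ?Q = "take j P"
    have "(1 - \<tau>) ^ (k - j) \<ge> 1 - real (k - j) * \<tau>"
      using Bernoulli_inequality[of "- \<tau>" "k - j"] tau_bounds by simp
    moreover have "real (k - j) * \<tau> \<le> m * \<tau>" using tau_bounds unfolding j_def by (intro mult_right_mono) auto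
    ultimately have pw: "(1 - \<tau>) ^ (k - j) \<ge> 1 - 5 * \<epsilon>\<^sup>2" using mt by linarith
    have "(1 + \<delta> / 2) \<le> (1 + \<delta>) * (1 - 5 * \<epsilon>\<^sup>2)"
    proof -
      have "(1 + \<delta>) * (5 * \<epsilon>\<^sup>2) \<le> (3/2) * (5 * \<epsilon>\<^sup>2)" using del_le by (intro mult_right_mono) auto
      then show ?thesis using e2 by (simp add: algebra_simps)
    qed
    also have "\<dots> \<le> (1 + \<delta>) * (1 - \<tau>) ^ (k - j)" using pw del_pos by (intro mult_left_mono) auto
    finally have "(1 + \<delta> / 2) * (d / n * card (free ?Q b)) \<le> (1 + \<delta>) * (1 - \<tau>) ^ (k - j) * (d / n * card (free ?Q b))"
      using d_pos n_pos by (intro mult_right_mono) auto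
    also have "\<dots> = \<tau> * ((1 - \<tau>) ^ (k - j) * card (free ?Q b))" by (simp add: \<tau>_def)
    also have "\<dots> \<le> \<tau> * card (free P b)"
      using free_step[OF gP(1) kb(1), of j] gP(2) kb(2) jk tau_bounds by (intro mult_left_mono) auto
    also have "\<dots> < real (card {y \<in> free P b. C w y})" using w unfolding typical_def by auto
    also have "\<dots> \<le> real (card {y \<in> free ?Q b. C w y})"
      using finV by (intro of_nat_mono card_mono) (auto simp: free_def)
    finally show "w \<in> {w \<in> Y ?Q. C (last P) w}" using w unfolding Y_def atypical_def by (simp add: mult.assoc)
  qed
  have "(\<Sum>P\<in>walks k. real (card {w \<in> V. C (last P) w \<and> \<not> typical P b w}))
     \<le> (\<Sum>P\<in>walks k. real (card {w \<in> Y (take j P). C (last P) w}))"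
    using sub finite_subset[OF YV finV] by (intro sum_mono of_nat_mono card_mono) auto
  also have "\<dots> \<le> d / n * (\<Sum>P\<in>walks k. real (card (Y (take j P)))) + \<rho> * d * (sqrt (\<epsilon> ^ 8 * n) * endpoint_norm j k)"
    using mixing_walks[OF jk k, of Y "\<epsilon> ^ 8 * n"] YV Yc by auto
  also have "\<dots> \<le> d * num_walks k * \<epsilon> ^ 8 + d * num_walks k * (8 * \<epsilon> ^ 6)"
  proof (rule add_mono)
    have "(\<Sum>P\<in>walks k. real (card (Y (take j P)))) \<le> num_walks k * (\<epsilon> ^ 8 * n)"
      using sum_bounded_above[of "walks k" "\<lambda>P. real (card (Y (take j P)))" "\<epsilon> ^ 8 * n"]
        Yc walks_take[of _ k j] jk unfolding num_walks_def by auto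
    then have "d / n * (\<Sum>P\<in>walks k. real (card (Y (take j P)))) \<le> d / n * (num_walks k * (\<epsilon> ^ 8 * n))"
      using d_pos n_pos by (intro mult_left_mono) auto
    then show "d / n * (\<Sum>P\<in>walks k. real (card (Y (take j P)))) \<le> d * num_walks k * \<epsilon> ^ 8"
      using n_pos by (simp add: mult_ac)
    have "sqrt (\<epsilon> ^ 8 * n) = \<epsilon> ^ 4 * sqrt n"
    proof (rule real_sqrt_unique)
      have "(\<epsilon> ^ 4 * sqrt n)\<^sup>2 = (\<epsilon> ^ 4)\<^sup>2 * (sqrt n)\<^sup>2" by (rule power_mult_distrib)
      also have "(\<epsilon> ^ 4)\<^sup>2 = \<epsilon> ^ 8" by (simp flip: power_mult)
      also have "(sqrt n)\<^sup>2 = n" using n_pos by simp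
      finally show "(\<epsilon> ^ 4 * sqrt n)\<^sup>2 = \<epsilon> ^ 8 * n" .
    qed (use eps_pos n_pos in auto)
    then have "\<rho> * d * (sqrt (\<epsilon> ^ 8 * n) * endpoint_norm j k) = \<epsilon> ^ 4 * (\<rho> * d * (sqrt n * endpoint_norm (k - m) k))"
      by (simp add: j_def)
    also have "\<dots> \<le> \<epsilon> ^ 4 * (d * num_walks k * (8 * \<epsilon>\<^sup>2))"
      using eps_pos by (intro mult_left_mono rho_endpoint_norm_le[OF gr k m(1) Xq]) auto
    also have "\<dots> = d * num_walks k * (8 * \<epsilon> ^ 6)" by (simp add: eval_nat_numeral)
    finally show "\<rho> * d * (sqrt (\<epsilon> ^ 8 * n) * endpoint_norm j k) \<le> d * num_walks k * (8 * \<epsilon> ^ 6)" .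
  qed
  also have "\<dots> = d * num_walks k * (\<epsilon> ^ 8 + 8 * \<epsilon> ^ 6)" by (simp add: algebra_simps)
  also have "\<dots> \<le> d * num_walks k * \<epsilon>\<^sup>2"
  proof (intro mult_left_mono)
    have "\<epsilon> ^ 8 \<le> \<epsilon> ^ 3" "\<epsilon> ^ 6 \<le> \<epsilon> ^ 3" by (intro eps_power_le; simp)+
    moreover have "\<epsilon> ^ 3 = \<epsilon> * \<epsilon>\<^sup>2" by (simp add: eval_nat_numeral)
    moreover have "\<epsilon> * \<epsilon>\<^sup>2 \<le> 1/400 * \<epsilon>\<^sup>2" using eps_small by (intro mult_right_mono) auto
    ultimately show "\<epsilon> ^ 8 + 8 * \<epsilon> ^ 6 \<le> \<epsilon>\<^sup>2" using zero_le_power2[of \<epsilon>] by linarith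
  qed (use d_pos num_walks_nonneg in auto)
  finally show ?thesis .
qed

section \<open>Growth of the number of walks\<close>

lemma exists_scale:
  "\<exists>m > 0. real (m - 1) \<le> 2 * X \<and> X * q ^ (m - 1) \<le> 1 / \<epsilon>\<^sup>2 \<and> ((m = 1 \<and> X \<le> 1 / \<epsilon>\<^sup>2) \<or> X \<ge> 1 / \<epsilon>\<^sup>2)"
proof (cases "X \<le> 1 / \<epsilon>\<^sup>2")
  case True
  then show ?thesis using X_bounds by (intro exI[of _ 1]) auto
next
  case False
  \<comment> \<open>The witness is \<open>N + 1\<close>, leaving N factors of q. A number of steps
    linear in X is affordable in \<open>recent_chords\<close>, and the crude rate
    \<open>q \<le> 1/2\<close> with \<open>X \<le> 2 ^ N\<close> then removes the
    concentration.\<close>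
  define N where "N = nat \<lceil>X\<rceil>"
  have N: "X \<le> N" "N \<le> X + 1" unfolding N_def using X_bounds(1) by linarith+
  have "real N < 2 ^ N" by (rule of_nat_less_two_power)
  then have "X \<le> 2 ^ N" using N by linarith
  then have "X * q ^ N \<le> 2 ^ N * (1/2) ^ N"
    using q_bounds X_bounds(1) by (intro mult_mono power_mono) auto
  also have "\<dots> = 1" by (simp flip: power_mult_distrib)
  also have "1 \<le> 1 / \<epsilon>\<^sup>2" using eps_pos eps_power_le[of 0 2] by simp
  finally show ?thesis using False N X_bounds(1) by (intro exI[of _ "Suc N"]) auto
qed

text \<open>\<open>W P\<close> only asks to avoid the prefix, so mixing counts it in total as nearly
  a proportion \<open>\<epsilon>\<close> of the expected d continuations. A candidate in
  \<open>W P\<close> that is not \<open>ok\<close> is charged either to a chord to one of the recent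
  vertices or to a window for which it is not typical.\<close>

lemma growth_step:
  assumes gr: "growing k" and k: "0 < k"
  shows "num_walks (Suc k) \<ge> \<epsilon> / 2 * d * num_walks k"
proof -
  obtain m where m: "m > 0" "real (m - 1) \<le> 2 * X" "X * q ^ (m - 1) \<le> 1 / \<epsilon>\<^sup>2"
    and mX: "(m = 1 \<and> X \<le> 1 / \<epsilon>\<^sup>2) \<or> X \<ge> 1 / \<epsilon>\<^sup>2" using exists_scale by (elim exE conjE) (rule that; assumption)
  define j where "j = k - m"
  have jk: "j \<le> k" unfolding j_def by simp
  define s where "s = window_start k"
  have s: "s \<in> windows k" unfolding s_def by (rule window_start_in)
  then have sw: "K dvd s" "k \<le> s + 2 * K" unfolding windows_def by auto
  define W where "W P = {w \<in> free (take j P) s. C (last P) w}" for P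
  define D where "D i P = {w \<in> V. C (P ! i) w \<and> C (last P) w}" for i P
  define F where "F b P = {w \<in> V. C (last P) w \<and> \<not> typical P b w}" for b P
  have fin: "finite (W P)" "finite (D i P)" "finite (F b P)" for P i b
    unfolding W_def D_def F_def using finV by auto
  have per: "real (card (W P)) \<le> real (card {w \<in> V. ok P w}) + (\<Sum>i\<in>{j..<k - 1}. real (card (D i P))) + (\<Sum>b\<in>windows k. real (card (F b P)))"
    if P: "P \<in> walks k" for P
  proof -
    have len: "length P = k" using P unfolding walks_def by simp
    have "W P \<subseteq> {w \<in> V. ok P w} \<union> (\<Union>i\<in>{j..<k - 1}. D i P) \<union> (\<Union>b\<in>windows k. F b P)"
    proof
      fix w assume w: "w \<in> W P"
      then have wV: "w \<in> V" and Cw: "C (last P) w" and wf: "w \<in> free (take j P) s"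
        using free_sub[of "take j P" s] unfolding W_def by auto
      show "w \<in> {w \<in> V. ok P w} \<union> (\<Union>i\<in>{j..<k - 1}. D i P) \<union> (\<Union>b\<in>windows k. F b P)"
      proof (cases "w \<in> free (butlast P) s")
        case True
        show ?thesis
        proof (cases "\<forall>b\<in>windows k. typical P b w")
          case T: True
          then have "ok P w" unfolding ok_def using True Cw len s_def by simp
          then show ?thesis using wV by simp
        next
          case False
          then show ?thesis using wV Cw unfolding F_def by blast
        qed
      next
        case False
        then obtain i where i: "s \<le> i" "i < k - 1" "C (P ! i) w"
          using wV len unfolding free_def by (auto simp: nth_butlast)
        have "j \<le> i"
        proof (rule ccontr)
          assume "\<not> j \<le> i"
          then show False using wf i len jk unfolding free_def by auto
        qed
        then show ?thesis using i wV Cw unfolding D_def by auto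
      qed
    qed
    then have "card (W P) \<le> card ({w \<in> V. ok P w} \<union> (\<Union>i\<in>{j..<k - 1}. D i P) \<union> (\<Union>b\<in>windows k. F b P))"
      using fin finV finite_windows by (intro card_mono) auto
    also have "\<dots> \<le> card {w \<in> V. ok P w} + card (\<Union>i\<in>{j..<k - 1}. D i P) + card (\<Union>b\<in>windows k. F b P)"
      by (intro order_trans[OF card_Un_le] add_right_mono card_Un_le)
    also have "\<dots> \<le> card {w \<in> V. ok P w} + (\<Sum>i\<in>{j..<k - 1}. card (D i P)) + (\<Sum>b\<in>windows k. card (F b P))"
      using finite_windows by (intro add_mono order_refl card_UN_le) auto
    finally have "real (card (W P)) \<le> real (card {w \<in> V. ok P w} + (\<Sum>i\<in>{j..<k - 1}. card (D i P)) + (\<Sum>b\<in>windows k. card (F b P)))"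
      by (rule of_nat_mono)
    then show ?thesis by (simp only: of_nat_add of_nat_sum)
  qed
  have aS: "num_walks (Suc k) = (\<Sum>P\<in>walks k. real (card {w \<in> V. ok P w}))"
    using sum_walks_Suc[of "\<lambda>_. 1" k] by (simp add: num_walks_def card_eq_sum)
  have "(\<Sum>P\<in>walks k. real (card (W P))) \<le> (\<Sum>P\<in>walks k. real (card {w \<in> V. ok P w}) + (\<Sum>i\<in>{j..<k - 1}. real (card (D i P))) + (\<Sum>b\<in>windows k. real (card (F b P))))"
    using per by (rule sum_mono)
  also have "\<dots> = num_walks (Suc k) + (\<Sum>i\<in>{j..<k - 1}. \<Sum>P\<in>walks k. real (card (D i P))) + (\<Sum>b\<in>windows k. \<Sum>P\<in>walks k. real (card (F b P)))"
    unfolding aS sum.distrib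
    by (intro arg_cong2[where f = "(+)"] refl sum.swap)
  also have "(\<Sum>i\<in>{j..<k - 1}. \<Sum>P\<in>walks k. real (card (D i P))) \<le> d * num_walks k * (38 * \<epsilon>\<^sup>2)"
    unfolding D_def j_def using mX by (intro recent_chords[OF gr k m(1,2)]) auto
  also have "(\<Sum>b\<in>windows k. \<Sum>P\<in>walks k. real (card (F b P))) \<le> (\<Sum>b\<in>windows k. d * num_walks k * \<epsilon>\<^sup>2)"
  proof (rule sum_mono)
    fix b assume b: "b \<in> windows k"
    show "(\<Sum>P\<in>walks k. real (card (F b P))) \<le> d * num_walks k * \<epsilon>\<^sup>2"
      unfolding F_def using mX atypical_extensions_dense[OF k b] atypical_extensions_sparse[OF gr k b m] by blast
  qed
  also have "\<dots> \<le> 2 * (d * num_walks k * \<epsilon>\<^sup>2)"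
  proof -
    have "real (card (windows k)) * (d * num_walks k * \<epsilon>\<^sup>2) \<le> 2 * (d * num_walks k * \<epsilon>\<^sup>2)"
      using card_windows[of k] d_pos num_walks_nonneg by (intro mult_right_mono) auto
    then show ?thesis by simp
  qed
  finally have up: "(\<Sum>P\<in>walks k. real (card (W P))) \<le> num_walks (Suc k) + d * num_walks k * (38 * \<epsilon>\<^sup>2) + 2 * (d * num_walks k * \<epsilon>\<^sup>2)" by simp
  have "\<epsilon> * d * num_walks k - d * num_walks k * (8 * \<epsilon>\<^sup>2) \<le> (\<Sum>P\<in>walks k. real (card (W P)))"
  proof -
    have fV: "real (card (free Q s)) \<le> n" for Q
      unfolding n_def using free_sub finV by (intro of_nat_mono card_mono)
    have "num_walks k * (\<epsilon> * n) \<le> (\<Sum>P\<in>walks k. real (card (free (take j P) s)))"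
    proof -
      have "(\<Sum>P\<in>walks k. \<epsilon> * n) \<le> (\<Sum>P\<in>walks k. real (card (free (take j P) s)))"
        using sw jk by (intro sum_mono card_free) (auto simp: walks_def intro: good_take)
      then show ?thesis by (simp add: num_walks_def)
    qed
    then have "d / n * (num_walks k * (\<epsilon> * n)) \<le> d / n * (\<Sum>P\<in>walks k. real (card (free (take j P) s)))"
      using d_pos n_pos by (intro mult_left_mono) auto
    moreover have "d / n * (num_walks k * (\<epsilon> * n)) = \<epsilon> * d * num_walks k" using n_pos by simp
    moreover have "\<rho> * d * (sqrt n * endpoint_norm j k) \<le> d * num_walks k * (8 * \<epsilon>\<^sup>2)"
      unfolding j_def by (rule rho_endpoint_norm_le[OF gr k m(1,3)])
    moreover have "\<bar>(\<Sum>P\<in>walks k. real (card (W P))) - d / n * (\<Sum>P\<in>walks k. real (card (free (take j P) s)))\<bar> \<le> \<rho> * d * (sqrt n * endpoint_norm j k)"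
      unfolding W_def by (intro mixing_walks[OF jk k] free_sub fV)
    ultimately show ?thesis by linarith
  qed
  \<comment> \<open>48 = 8 + 38 + 2: the decoupling error, the recent chords, and at most two
    windows.\<close>
  with up have "d * num_walks k * (\<epsilon> - 48 * \<epsilon>\<^sup>2) \<le> num_walks (Suc k)" by (simp add: algebra_simps)
  moreover have "d * num_walks k * (\<epsilon> / 2) \<le> d * num_walks k * (\<epsilon> - 48 * \<epsilon>\<^sup>2)"
  proof (intro mult_left_mono)
    have "\<epsilon>\<^sup>2 \<le> \<epsilon> * (1/400)"
      unfolding power2_eq_square using eps_pos eps_small by (intro mult_left_mono) auto
    then show "\<epsilon> / 2 \<le> \<epsilon> - 48 * \<epsilon>\<^sup>2" using eps_pos by simp
  qed (use d_pos num_walks_nonneg in auto)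
  ultimately show ?thesis by (simp add: mult_ac)
qed

text \<open>A first vertex only has to be typical for the single window starting at 0, whose free
  set is V; few vertices fail this.\<close>

lemma num_walks_1: "num_walks 1 \<ge> n / 2"
proof -
  have a1: "num_walks 1 = real (card {w \<in> V. ok [] w})"
    using sum_walks_Suc[of "\<lambda>_. 1" 0] by (simp add: num_walks_def card_eq_sum walks_0)
  have w0: "windows 0 = {0}" unfolding windows_def using K_pos by auto
  have f0: "free [] b = V" for b unfolding free_def by auto
  have "V \<subseteq> {w \<in> V. ok [] w} \<union> atypical \<delta> (free [] 0)"
    using not_typical_iff[of _ "[]" 0] unfolding ok_def by (auto simp: w0 f0)
  then have "card V \<le> card ({w \<in> V. ok [] w} \<union> atypical \<delta> (free [] 0))"
    using finV by (intro card_mono) (auto simp: atypical_def)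
  also have "\<dots> \<le> card {w \<in> V. ok [] w} + card (atypical \<delta> (free [] 0))" by (rule card_Un_le)
  finally have "n \<le> num_walks 1 + real (card (atypical \<delta> (free [] 0)))" unfolding a1 n_def by simp
  moreover have "real (card (atypical \<delta> (free [] 0))) \<le> \<epsilon> ^ 8 * n"
    using del_pos by (intro card_atypical_free) auto
  moreover have "\<epsilon> ^ 8 * n \<le> 1/2 * n"
    using eps_power_le[of 1 8] eps_small n_pos by (intro mult_right_mono) auto
  ultimately show ?thesis by simp
qed

lemma all_growing: "growing k"
proof (induction k)
  case 0
  then show ?case using num_walks_1 unfolding growing_def by simp
next
  case (Suc k)
  then show ?case using growth_step[OF Suc.IH] unfolding growing_def by (auto simp: less_Suc_eq)
qed

lemma num_walks_pos: "k > 0 \<Longrightarrow> num_walks k > 0"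
proof (induction k rule: nat_induct_non_zero)
  case 1
  then show ?case using num_walks_1 n_pos by linarith
next
  case (Suc k)
  have "0 < \<epsilon> / 2 * d * num_walks k" using Suc eps_pos d_pos by simp
  also have "\<dots> \<le> num_walks (Suc k)" by (rule growth_step[OF all_growing Suc.hyps])
  finally show ?case .
qed

theorem exists_long_walk:
  "\<exists>P. length P = L \<and> set P \<subseteq> V \<and> (\<forall>i. Suc i < L \<longrightarrow> C (P ! i) (P ! Suc i)) \<and>
     (\<forall>i k. i + 2 \<le> k \<longrightarrow> k \<le> i + K \<longrightarrow> k < L \<longrightarrow> \<not> C (P ! i) (P ! k))"
proof (cases "L = 0")
  case False
  then have "num_walks L > 0" by (intro num_walks_pos) simp
  then obtain P where "P \<in> walks L" unfolding num_walks_def by fastforce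
  then have gP: "good P" and len: "length P = L" unfolding walks_def by auto
  have ok: "ok (take i P) (P ! i)" if "i < L" for i using gP that len unfolding good_def by simp
  have "C (P ! i) (P ! Suc i)" if i: "Suc i < L" for i
  proof -
    have "last (take (Suc i) P) = P ! i" using i len by (simp add: take_Suc_conv_app_nth)
    moreover have "take (Suc i) P \<noteq> []" using i len by auto
    ultimately show ?thesis using ok[OF i] unfolding ok_def by metis
  qed
  moreover have "\<not> C (P ! i) (P ! k)" if ik: "i + 2 \<le> k" "k \<le> i + K" "k < L" for i k
  proof -
    have "P ! k \<in> free (butlast (take k P)) (window_start k)"
      using ok[OF ik(3)] ik len unfolding ok_def by simp
    moreover have "window_start k \<le> i" using window_start_le[of k] ik by linarith
    ultimately show ?thesis using ik len unfolding free_def by (auto simp: nth_butlast)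
  qed
  ultimately show ?thesis using len good_set[OF gP] by (intro exI[of _ P]) auto
qed auto

end

section \<open>Long induced cycles\<close>

text \<open>Since \<open>ln (1 - t) \<ge> - t / (1 - t)\<close>, keeping \<open>1 - t\<close> above
  \<open>u\<close> costs only the factor \<open>1 / u\<close> in the exponent. This covers values of
  d/n that do not tend to 0.\<close>

lemma power_one_minus_ge:
  fixes t u L :: real
  assumes t: "0 \<le> t" "0 < u" "u \<le> 1 - t" and m: "real m * t \<le> u * L"
  shows "exp (- L) \<le> (1 - t) ^ m"
proof -
  have "- L \<le> - (real m * (t / u))" using m t by (simp add: field_simps)
  also have "t / (1 - t) \<le> t / u" using t by (intro divide_left_mono) auto
  then have "real m * (t / (1 - t)) \<le> real m * (t / u)" by (intro mult_left_mono) auto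
  then have "- (real m * (t / u)) \<le> real m * - (t / (1 - t))"
    unfolding mult_minus_right by linarith
  \<comment> \<open>This is \<open>ln (1 + x) \<le> x\<close> at \<open>x = t / (1 - t)\<close>,
    where \<open>1 + x = 1 / (1 - t)\<close>.\<close>
  also have "- (t / (1 - t)) \<le> ln (1 - t)"
    using ln_one_minus_pos_lower_bound[of t] t ln_add_one_self_le_self2[of "t / (1 - t)"] ln_inverse[of "1 - t"]
    by (simp add: field_simps)
  then have "real m * - (t / (1 - t)) \<le> real m * ln (1 - t)" by (intro mult_left_mono) auto
  finally have "exp (- L) \<le> exp (real m * ln (1 - t))" by simp
  also have "\<dots> = (1 - t) ^ m" using t by (simp add: exp_of_nat_mult)
  finally show ?thesis .
qed

text \<open>\<open>\<epsilon>\<close> is the 30th root of \<lambda>/d, so that the regularity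
  parameter, its cube root, becomes \<open>\<epsilon> ^ 10\<close>. The mixing error is then of
  relative order \<open>\<epsilon> ^ 10\<close>, which leaves ample room below
  \<open>\<rho> = \<epsilon> ^ 5\<close>.\<close>

lemma spectral_graph_induced_cycle:
  fixes n d :: nat and \<epsilon> \<alpha> \<delta> l :: real
  assumes \<alpha>: "0 < \<alpha>" "\<alpha> < 1" and \<delta>: "\<delta> = (1 - \<alpha>) / 2" and n: "n \<ge> 1" and d: "d \<ge> 1" and dn: "real d \<le> \<alpha> * real n"
    and G: "nearly_regular_spectral_graph n (\<epsilon> ^ 10) (real d) (\<epsilon> ^ 30 * d) E"
    and eps: "0 \<le> \<epsilon>" "\<epsilon> \<le> \<delta>\<^sup>2 / 100" "\<epsilon> \<le> exp (- 9 / \<delta>)"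
  shows "\<epsilon> > 0 \<and> (\<exists>vs. induced_cycle n E vs \<and> real (length vs) \<ge> \<delta> / 3 * real n * ln (1 / \<epsilon>) / real d)"
proof -
  have del: "0 < \<delta>" "\<delta> \<le> 1/2" using \<alpha> unfolding \<delta> by auto
  have "\<delta>\<^sup>2 \<le> (1/2)\<^sup>2" using del by (intro power_mono) auto
  then have e400: "\<epsilon> \<le> 1/400" using eps by (simp add: power2_eq_square)
  have epow: "\<epsilon> ^ m \<le> \<epsilon> ^ k" if "k \<le> m" for k m using eps e400 that by (intro power_decreasing) auto
  have E: "simple_graph n E" using G unfolding nearly_regular_spectral_graph_def by blast
  have degs: "(1 - \<epsilon> ^ 10) * d \<le> degree_in E v" "degree_in E v \<le> (1 + \<epsilon> ^ 10) * d" if "v < n" for v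
    using G that unfolding nearly_regular_spectral_graph_def by auto
  have e10: "\<epsilon> ^ 10 \<le> 1/4" using epow[of 1 10] e400 by simp
  have e30: "\<epsilon> ^ 30 \<le> \<epsilon> ^ 10" by (rule epow) simp
  have mixA: "\<bar>(\<Sum>x<n. \<Sum>y<n. f x * of_bool ({x, y} \<in> E) * g y) - d / n * (\<Sum>x<n. f x) * (\<Sum>y<n. g y)\<bar>
    \<le> (9 * \<epsilon> ^ 10) * d * L2_set f {..<n} * L2_set g {..<n}" for f g
  proof -
    have "\<epsilon> ^ 30 * d \<le> 1/2 * d" using e30 e10 by (intro mult_right_mono) auto
    then have "\<bar>(\<Sum>x<n. \<Sum>y<n. f x * of_bool ({x, y} \<in> E) * g y) - d / n * (\<Sum>x<n. f x) * (\<Sum>y<n. g y)\<bar>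
      \<le> (\<epsilon> ^ 30 * d + 8 * \<epsilon> ^ 10 * d) * L2_set f {..<n} * L2_set g {..<n}"
      using n d eps e10 by (intro spectral_graph_mixing[OF G]) auto
    also have "\<dots> \<le> ((9 * \<epsilon> ^ 10) * d) * L2_set f {..<n} * L2_set g {..<n}"
    proof (intro mult_right_mono)
      have "\<epsilon> ^ 30 * d \<le> \<epsilon> ^ 10 * d" using e30 by (intro mult_right_mono) auto
      then show "\<epsilon> ^ 30 * d + 8 * \<epsilon> ^ 10 * d \<le> (9 * \<epsilon> ^ 10) * d" by linarith
    qed auto
    finally show ?thesis .
  qed
  have "(1 - \<alpha>)\<^sup>2 / 2 \<le> (9 * \<epsilon> ^ 10)\<^sup>2 * d"
  proof (rule mixing_parameter_lower_bound[OF E _ dn _ _ _ \<alpha>(2) mixA])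
    show "0 < n" using n by simp
    have "1/2 * real d \<le> (1 - \<epsilon> ^ 10) * d" using e10 by (intro mult_right_mono) auto
    then show "real d / 2 \<le> degree_in E 0" using degs(1)[of 0] n by simp
  qed (use d eps in auto)
  \<comment> \<open>Besides forcing \<open>\<epsilon> > 0\<close>, this makes d large in terms of
    \<open>\<epsilon>\<close>, which the reflexive relation \<open>C\<close> requires.\<close>
  then have low: "2 * \<delta>\<^sup>2 \<le> 81 * \<epsilon> ^ 20 * d"
    unfolding \<delta> by (simp add: power_mult_distrib power_divide flip: power_mult)
  have e0: "\<epsilon> > 0"
  proof (rule ccontr)
    assume "\<not> \<epsilon> > 0"
    then have "\<epsilon> = 0" using eps by simp
    then show False using low del by simp
  qed
  define \<rho> where "\<rho> = \<epsilon> ^ 5"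
  \<comment> \<open>The summand 1 is the norm of the identity contained in \<open>C\<close>. By
    \<open>low\<close> and \<open>100 * \<epsilon> \<le> \<delta> ^ 2\<close> it is at most
    \<open>81/200 * \<epsilon> ^ 19 * d\<close>, so both terms are small multiples of
    \<open>\<epsilon> ^ 6 * d\<close>.\<close>
  have rho: "9 * \<epsilon> ^ 10 * d + 1 \<le> \<rho> * d"
  proof -
    have "100 * \<epsilon> * 2 \<le> 2 * \<delta>\<^sup>2" using eps by simp
    also have "\<dots> \<le> 81 * \<epsilon> ^ 20 * d" by fact
    also have "\<dots> = \<epsilon> * (81 * \<epsilon> ^ 19 * d)" by (simp add: eval_nat_numeral)
    finally have "\<epsilon> * 200 \<le> \<epsilon> * (81 * \<epsilon> ^ 19 * d)" by simp
    then have "200 \<le> 81 * \<epsilon> ^ 19 * d" using e0 by (rule mult_left_le_imp_le)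
    moreover have "\<epsilon> ^ 19 * d \<le> \<epsilon> ^ 6 * d" "\<epsilon> ^ 10 * d \<le> \<epsilon> ^ 6 * d" by (intro mult_right_mono epow; simp)+
    moreover have "\<epsilon> ^ 6 * d \<le> 1/400 * (\<rho> * d)"
    proof -
      have "\<epsilon> * (\<rho> * d) \<le> 1/400 * (\<rho> * d)" unfolding \<rho>_def using e400 e0 by (intro mult_right_mono) auto
      then show ?thesis unfolding \<rho>_def by (simp add: eval_nat_numeral mult_ac)
    qed
    ultimately show ?thesis by linarith
  qed
  define L where "L = ln (1 / \<epsilon>)"
  have L9: "9 / \<delta> \<le> L"
  proof -
    have "ln \<epsilon> \<le> - 9 / \<delta>" using eps(3) e0 by (metis ln_exp ln_mono exp_gt_zero)
    then show ?thesis unfolding L_def using e0 by (simp add: ln_div)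
  qed
  \<comment> \<open>The 3 comes from the two blocks of a window and
    \<open>1 + \<delta> \<le> 3/2\<close>: thus
    \<open>2 * K * \<tau> \<le> 3 * K * (d / n) \<le> \<delta> * L\<close>. The bound
    \<open>exp (- 9 / \<delta>)\<close> on \<open>\<epsilon>\<close> is chosen to give
    \<open>K \<ge> 3\<close>.\<close>
  define K where "K = nat \<lfloor>\<delta> * L * n / (3 * d)\<rfloor>"
  have ndr: "real d \<le> real n" using dn \<alpha> n by (meson mult_left_le_one_le less_imp_le of_nat_0_le_iff order_trans)
  have "0 < 9 / \<delta>" using del by simp
  then have L0: "0 < L" using L9 by linarith
  have "3 \<le> \<delta> * L / 3" using L9 del by (simp add: field_simps)
  also have "\<dots> = \<delta> * L / 3 * 1" by simp
  also have "\<dots> \<le> \<delta> * L / 3 * (n / d)"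
    using ndr d L0 del by (intro mult_left_mono) (auto simp: divide_simps)
  also have "\<dots> = \<delta> * L * n / (3 * d)" by simp
  finally have big: "3 \<le> \<delta> * L * n / (3 * d)" .
  have K3: "K \<ge> 3" unfolding K_def using big by (simp add: le_nat_iff le_floor_iff)
  have Kle: "real K \<le> \<delta> * L * n / (3 * d)" unfolding K_def using big by simp
  have Kgt: "\<delta> * L * n / (3 * d) < real K + 1" unfolding K_def using big by linarith
  define \<tau> where "\<tau> = (1 + \<delta>) * (real d / n)"
  have dna: "real d / n \<le> \<alpha>" using dn n by (simp add: divide_le_eq)
  \<comment> \<open>With \<open>\<alpha> = 1 - 2 * \<delta>\<close> the product
    \<open>(1 + \<delta>) * \<alpha>\<close> is
    \<open>1 - \<delta> - 2 * \<delta> ^ 2\<close>.\<close>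
  have tau1: "\<tau> \<le> 1 - \<delta>"
  proof -
    have "\<tau> \<le> (1 + \<delta>) * \<alpha>" unfolding \<tau>_def using dna del by (intro mult_left_mono) auto
    also have "\<dots> \<le> 1 - \<delta>"
      using zero_le_power2[of "1 - \<alpha>"] unfolding \<delta> by (simp add: field_simps power2_eq_square)
    finally show ?thesis .
  qed
  have pw: "\<epsilon> \<le> (1 - \<tau>) ^ (2 * K)"
  proof -
    have "real (2 * K) * \<tau> \<le> \<delta> * L"
    proof -
      have "real (2 * K) * \<tau> = 2 * real K * (d / n) * (1 + \<delta>)" unfolding \<tau>_def by simp
      also have "\<dots> \<le> 2 * real K * (d / n) * (3/2)" using del by (intro mult_left_mono) auto
      also have "\<dots> = 3 * (d / n) * real K" by simp
      also have "\<dots> \<le> 3 * (d / n) * (\<delta> * L * n / (3 * d))" using Kle by (intro mult_left_mono) auto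
      also have "\<dots> = \<delta> * L" using n d by simp
      finally show ?thesis .
    qed
    moreover have "0 \<le> \<tau>" unfolding \<tau>_def using del by simp
    ultimately have "exp (- L) \<le> (1 - \<tau>) ^ (2 * K)" using tau1 del by (intro power_one_minus_ge[of \<tau> \<delta>]) auto
    moreover have "exp (- L) = \<epsilon>" unfolding L_def using e0 by (simp add: ln_div)
    ultimately show ?thesis by simp
  qed
  define C where "C x y \<longleftrightarrow> x = y \<or> {x, y} \<in> E" for x y
  interpret walk_count "{..<n}" C "real d" \<rho> K \<epsilon> \<delta>
  proof
    show "real (card {y \<in> {..<n}. C x y}) \<le> 3 * real d" if "x \<in> {..<n}" for x
    proof -
      have "{y \<in> {..<n}. C x y} \<subseteq> insert x {y \<in> {..<n}. {x, y} \<in> E}" unfolding C_def by auto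
      then have "card {y \<in> {..<n}. C x y} \<le> card (insert x {y \<in> {..<n}. {x, y} \<in> E})" by (intro card_mono) auto
      also have "\<dots> \<le> Suc (degree_in E x)" unfolding degree_in_eq[OF E] by (rule card_insert_le_m1) auto
      finally have "real (card {y \<in> {..<n}. C x y}) \<le> (1 + \<epsilon> ^ 10) * d + 1" using degs(2)[of x] that by simp
      also have "\<dots> \<le> 2 * real d + 1" using e10 by (intro add_right_mono mult_right_mono) auto
      finally show ?thesis using d by simp
    qed
    show "\<bar>(\<Sum>x<n. \<Sum>y<n. f x * of_bool (C x y) * g y) - real d / card {..<n} * sum f {..<n} * sum g {..<n}\<bar>
      \<le> \<rho> * real d * L2_set f {..<n} * L2_set g {..<n}" for f g
    proof -
      \<comment> \<open>There are no loops, so the form of \<open>C\<close> is that of the adjacency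
        matrix plus the inner product of f and g, which Cauchy-Schwarz bounds by the product of the
        norms.\<close>
      have "(\<Sum>x<n. \<Sum>y<n. f x * of_bool (C x y) * g y)
        = (\<Sum>x<n. \<Sum>y<n. f x * of_bool ({x, y} \<in> E) * g y + (if x = y then f x * g x else 0))"
        unfolding C_def using simple_graph_irrefl[OF E] by (intro sum.cong refl) (auto simp: of_bool_def)
      also have "\<dots> = (\<Sum>x<n. \<Sum>y<n. f x * of_bool ({x, y} \<in> E) * g y) + (\<Sum>x<n. f x * g x)"
        by (simp add: sum.distrib)
      finally have "\<bar>(\<Sum>x<n. \<Sum>y<n. f x * of_bool (C x y) * g y) - d / n * sum f {..<n} * sum g {..<n}\<bar>
        \<le> (9 * \<epsilon> ^ 10) * d * L2_set f {..<n} * L2_set g {..<n} + L2_set f {..<n} * L2_set g {..<n}"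
        using mixA[of f g] abs_sum_mult_le_L2[of f g "{..<n}"] by linarith
      also have "\<dots> = (9 * \<epsilon> ^ 10 * d + 1) * (L2_set f {..<n} * L2_set g {..<n})" by (simp add: algebra_simps)
      also have "\<dots> \<le> (\<rho> * d) * (L2_set f {..<n} * L2_set g {..<n})"
        using rho by (intro mult_right_mono) auto
      finally show ?thesis by (simp add: mult.assoc)
    qed
    show "{..<n} \<noteq> {}" using n by (simp add: lessThan_empty_iff)
    show "(1 + \<delta>) * (real d / card {..<n}) \<le> 1"
      using tau1 del unfolding \<tau>_def card_lessThan by linarith
  qed (use n d K3 e0 eps del tau1 pw in \<open>auto simp: \<rho>_def \<tau>_def\<close>)
  obtain P where P: "length P = n + 2" "set P \<subseteq> {..<n}" "\<And>i. Suc i < n + 2 \<Longrightarrow> C (P ! i) (P ! Suc i)"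
    "\<And>i k. i + 2 \<le> k \<Longrightarrow> k \<le> i + K \<Longrightarrow> k < n + 2 \<Longrightarrow> \<not> C (P ! i) (P ! k)"
    using exists_long_walk[of "n + 2"] by metis
  have "\<exists>vs. induced_cycle n E vs \<and> length vs > K"
    using P by (intro long_locally_induced_walk_imp_induced_cycle[OF E K3, of P]) (auto simp: C_def)
  then obtain vs where vs: "induced_cycle n E vs" "K < length vs" by blast
  \<comment> \<open>The strict inequality \<open>K < length vs\<close> makes up for rounding down in
    \<open>K\<close>.\<close>
  then have "\<delta> / 3 * real n * ln (1 / \<epsilon>) / real d \<le> real (length vs)"
    using Kgt unfolding L_def by (simp add: mult_ac)
  then show ?thesis using vs e0 by blast
qed

theorem theorem1p2:
  fixes \<alpha> :: real
  assumes "0 < \<alpha>" and "\<alpha> < 1"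
  shows "\<exists>c1 > 0. \<exists>c2 > 0. \<exists>c3 > 0. \<exists>N :: nat. \<forall>n \<ge> N. \<forall>d \<ge> N. real d \<le> \<alpha> * real n \<longrightarrow>
    (\<forall>(l :: real) E.
       nearly_regular_spectral_graph n (c3 * root 3 (l / real d)) (real d) l E \<longrightarrow>
       l \<le> c1 * real d \<longrightarrow>
       (\<exists>vs. induced_cycle n E vs \<and>
             real (length vs) \<ge> c2 * real n * ln (real d / l) / real d))"
proof -
  define \<delta> where "\<delta> = (1 - \<alpha>) / 2"
  \<comment> \<open>The two smallness conditions on \<open>\<epsilon>\<close>;
    \<open>c1 = e ^ 30\<close> turns \<lambda> \<le> c1 d into
    \<open>\<epsilon> \<le> e\<close>.\<close>
  define e where "e = min (\<delta>\<^sup>2 / 100) (exp (- 9 / \<delta>))"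
  have del: "\<delta> > 0" using assms unfolding \<delta>_def by simp
  have e: "e > 0" unfolding e_def using del by simp
  have main: "\<exists>vs. induced_cycle n E vs \<and> real (length vs) \<ge> \<delta> / 90 * real n * ln (real d / l) / real d"
    if n: "n \<ge> 1" and d: "d \<ge> 1" and dn: "real d \<le> \<alpha> * real n"
      and G: "nearly_regular_spectral_graph n (1 * root 3 (l / real d)) (real d) l E"
      and l: "l \<le> e ^ 30 * real d" for n d :: nat and l E
  proof -
    \<comment> \<open>That \<lambda> is nonnegative is read off from the condition \<gamma> \<ge> 0
      in the graph class.\<close>
    have "root 3 (l / d) \<ge> 0" using G unfolding nearly_regular_spectral_graph_def by simp
    then have t0: "l / d \<ge> 0" by simp
    define \<epsilon> where "\<epsilon> = root 30 (l / d)"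
    have eps0: "\<epsilon> \<ge> 0" unfolding \<epsilon>_def using t0 by simp
    have t: "l / d = \<epsilon> ^ 30" unfolding \<epsilon>_def using t0 by simp
    have "\<epsilon> ^ 30 \<le> e ^ 30" unfolding t[symmetric] using l d by (simp add: divide_le_eq)
    then have ee: "\<epsilon> \<le> e" using e by (simp add: power_mono_iff eps0)
    have r3: "root 3 (l / d) = \<epsilon> ^ 10"
      unfolding t using eps0 by (intro real_root_pos_unique) (auto simp flip: power_mult)
    have ld: "l = \<epsilon> ^ 30 * d" using t d by (simp add: field_simps)
    have "nearly_regular_spectral_graph n (\<epsilon> ^ 10) (real d) (\<epsilon> ^ 30 * d) E"
      using G unfolding mult_1 r3 unfolding ld .
    from spectral_graph_induced_cycle[OF assms \<delta>_def n d dn this eps0] ee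
    obtain vs where eps: "\<epsilon> > 0" and vs: "induced_cycle n E vs"
      "real (length vs) \<ge> \<delta> / 3 * real n * ln (1 / \<epsilon>) / real d" unfolding e_def by auto
    have "real d / l = (1 / \<epsilon>) ^ 30" unfolding ld using d eps by (simp add: field_simps)
    then have "ln (real d / l) = 30 * ln (1 / \<epsilon>)" using eps by (simp add: ln_realpow)
    then show ?thesis using vs by (intro exI[of _ vs]) simp
  qed
  show ?thesis
    \<comment> \<open>The 90 is 3 times 30, since
      \<open>ln (d / \<lambda>) = 30 * ln (1 / \<epsilon>)\<close>. The witnesses for
      \<open>c3\<close> and \<open>N\<close> are both 1; that d is large in terms of \<lambda>/d is
      supplied by \<open>mixing_parameter_lower_bound\<close>.\<close>
    by (rule exI[of _ "e ^ 30"], intro conjI, use e in simp, rule exI[of _ "\<delta> / 90"], intro conjI,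
        use del in simp, rule exI[of _ 1], intro conjI, simp, rule exI[of _ 1]) (use main in blast)
qed

end
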